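(* Let $n\ge 1$ and let $\psi_i=\psi_i^++\psi_i^-$, $1\le i\le 2n$, be field operators (all bosonic, $\sigma=+1$, or all fermionic, $\sigma=-1$) with pairwise distinct times $t_1,\dots,t_{2n}$, each split in an arbitrary way into a "positive" part $\psi_i^+$ and a "negative" part $\psi_i^-$. No symmetry of the normal ordered products or of the contractions is assumed, i.e. $N_{i,j}=\sigma N_{j,i}$ and $D_{i,j}=\sigma D_{j,i}$ are not required. Assume that the contractions are $c$-numbers, in the sense that for all $i\neq j$ and all signs $\epsilon,\epsilon'\in\{+,-\}$ the bracket $[\psi_i^{\epsilon},\psi_j^{\epsilon'}]_\sigma$ is a $c$-number. Then Wick's theorem holds in its usual form: $$T_{1,2,\dots,2n}=\sum_{m=0}^{n}\ \sum_{b\in B_m}(-1)^{p(b)}\,N_{b_1,b_2,\dots,b_{2m}}\prod_{j=m+1}^{n}D_{b_{2j-1},b_{2j}},$$ where $B_m$ is the set of permutations $b=(b_1,\dots,b_{2n})$ of $(1,\dots,2n)$ such that $b_1<b_2<\dots<b_{2m}$, $b_{2j-1}<b_{2j}$ for every $j=m+1,\dots,n$, and $b_{2m+1}<b_{2m+3}<\dots<b_{2n-1}$. Here $(-1)^{p(b)}=1$ if the fields are bosonic, and $(-1)^{p(b)}$ is the signature of $b$ if the fields are fermionic.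
   Context: Setting. $\mathcal A$ is an associative unital complex algebra (of operators), and $\psi_i^{+},\psi_i^{-}\in\mathcal A$ are given elements with $\psi_i=\psi_i^++\psi_i^-$. Either all fields are bosonic ($\sigma=+1$) or all are fermionic ($\sigma=-1$). A $c$-number is a scalar multiple of the identity. $[A,B]_\sigma:=AB-\sigma BA$. Each $\psi_i$ carries a time $t_i$ in a totally ordered set (e.g. real times, or position along a contour in the complex time plane), and $\theta(t-t')=1$ if $t$ is later than $t'$ and $0$ if it is earlier. Time ordering. $T_{a_1,\dots,a_k}$ is the product of $\psi_{a_1},\dots,\psi_{a_k}$ arranged so that later times stand to the left, multiplied, for fermionic fields, by the signature of the rearrangement. In particular $T_{1,2}=\psi_1\psi_2\,\theta(t_1-t_2)+\sigma\psi_2\psi_1\,\theta(t_2-t_1)$. Normal ordering. $N$ is defined on formal words in the symbols $\psi_i^{\pm}$: it places all "negative" parts to the left and all "positive" parts to the right, otherwise leaving the order unchanged (the negative parts keep their relative order, and so do the positive parts), with a sign change each time two fermionic symbols are interchanged. It is extended multilinearly via $\psi_i=\psi_i^++\psi_i^-$, and $N_{a_1,\dots,a_k}:=N[\psi_{a_1}\cdots\psi_{a_k}]\in\mathcal A$. For example $N_{1,2}=\psi_1^+\psi_2^++\psi_1^-\psi_2^++\sigma\psi_2^-\psi_1^++\psi_1^-\psi_2^-$. The empty normal ordered product (case $m=0$) is the identity. Contraction. $D_{i,j}:=T_{i,j}-N_{i,j}$, that is, $$D_{1,2}=\theta(t_1-t_2)[\psi_1^+,\psi_2^-]_\sigma-\theta(t_2-t_1)\{[\psi_1^+,\psi_2^+]_\sigma+[\psi_1^-,\psi_2^+]_\sigma+[\psi_1^-,\psi_2^-]_\sigma\}.$$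 *)

theory Defs
  imports Complex_Main "HOL-Combinatorics.Permutations"
begin

text \<open>Associative unital complex algebras. The sort \<open>{ring, monoid_mult}\<close> is
  \<open>ring_1\<close> without the requirement \<open>0 \<noteq> 1\<close>, so that the zero algebra is allowed.\<close>

locale complex_algebra = vector_space scale
  for scale :: "complex \<Rightarrow> 'a::{ring, monoid_mult} \<Rightarrow> 'a" +
  assumes scale_mult_left: "scale c x * y = scale c (x * y)"
    and scale_mult_right: "x * scale c y = scale c (x * y)"

definition c_number :: "(complex \<Rightarrow> 'a::{ring, monoid_mult} \<Rightarrow> 'a) \<Rightarrow> 'a \<Rightarrow> bool" where
  "c_number scale x \<longleftrightarrow> (\<exists>c. x = scale c 1)"

definition bracket ::
  "(complex \<Rightarrow> 'a::{ring, monoid_mult} \<Rightarrow> 'a) \<Rightarrow> complex \<Rightarrow> 'a \<Rightarrow> 'a \<Rightarrow> 'a" where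
  "bracket scale \<sigma> A B = A * B - scale \<sigma> (B * A)"

text \<open>In all that follows \<open>\<sigma>\<close> is \<open>1\<close> (bosonic fields) or \<open>-1\<close> (fermionic fields).\<close>

definition perm_factor :: "complex \<Rightarrow> (nat \<Rightarrow> nat) \<Rightarrow> complex" where
  "perm_factor \<sigma> p = (if \<sigma> = 1 then 1 else of_int (sign p))"

datatype part = Pos | Neg

text \<open>The split fields are given as \<open>\<psi> :: part \<Rightarrow> nat \<Rightarrow> 'a\<close>.\<close>

definition field_op :: "(part \<Rightarrow> nat \<Rightarrow> 'a::{ring, monoid_mult}) \<Rightarrow> nat \<Rightarrow> 'a" where
  "field_op \<psi> i = \<psi> Pos i + \<psi> Neg i"

text \<open>The sum runs over the permutations \<open>p\<close> of positions after which the times decrease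
  strictly from left to right. For pairwise distinct times there is exactly one; coinciding times,
  for which time ordering is not defined, give the junk value \<open>0\<close>.\<close>

definition time_ordered ::
  "(complex \<Rightarrow> 'a::{ring, monoid_mult} \<Rightarrow> 'a) \<Rightarrow> complex \<Rightarrow> (nat \<Rightarrow> 't::linorder) \<Rightarrow>
    (part \<Rightarrow> nat \<Rightarrow> 'a) \<Rightarrow> nat list \<Rightarrow> 'a" where
  "time_ordered scale \<sigma> t \<psi> as =
    (\<Sum>p | p permutes {..<length as} \<and>
        (\<forall>i j. i < j \<and> j < length as \<longrightarrow> t (as ! p j) < t (as ! p i)).
      scale (perm_factor \<sigma> p) (prod_list (map (\<lambda>i. field_op \<psi> (as ! p i)) [0..<length as])))"

text \<open>A formal word is a list of symbols \<open>(e, i)\<close> standing for \<open>\<psi> e i\<close>. Moving the negative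
  symbols to the left without any other reordering interchanges precisely the pairs in which a
  positive symbol stands to the left of a negative one.\<close>

definition normal_ordered_word ::
  "(complex \<Rightarrow> 'a::{ring, monoid_mult} \<Rightarrow> 'a) \<Rightarrow> complex \<Rightarrow>
    (part \<Rightarrow> nat \<Rightarrow> 'a) \<Rightarrow> (part \<times> nat) list \<Rightarrow> 'a" where
  "normal_ordered_word scale \<sigma> \<psi> w =
    scale (\<sigma> ^ card {(k, l). k < l \<and> l < length w \<and> fst (w ! k) = Pos \<and> fst (w ! l) = Neg})
      (prod_list (map (\<lambda>(e, i). \<psi> e i)
        (filter (\<lambda>s. fst s = Neg) w @ filter (\<lambda>s. fst s = Pos) w)))"

text \<open>Multilinear extension: the sum runs over all words obtained by choosing one of the
  two parts of each factor.\<close>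

definition normal_ordered ::
  "(complex \<Rightarrow> 'a::{ring, monoid_mult} \<Rightarrow> 'a) \<Rightarrow> complex \<Rightarrow>
    (part \<Rightarrow> nat \<Rightarrow> 'a) \<Rightarrow> nat list \<Rightarrow> 'a" where
  "normal_ordered scale \<sigma> \<psi> as =
    (\<Sum>es | set es \<subseteq> {Pos, Neg} \<and> length es = length as.
      normal_ordered_word scale \<sigma> \<psi> (zip es as))"

definition contraction ::
  "(complex \<Rightarrow> 'a::{ring, monoid_mult} \<Rightarrow> 'a) \<Rightarrow> complex \<Rightarrow> (nat \<Rightarrow> 't::linorder) \<Rightarrow>
    (part \<Rightarrow> nat \<Rightarrow> 'a) \<Rightarrow> nat \<Rightarrow> nat \<Rightarrow> 'a" where
  "contraction scale \<sigma> t \<psi> i j =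
    time_ordered scale \<sigma> t \<psi> [i, j] - normal_ordered scale \<sigma> \<psi> [i, j]"

definition wick_perms :: "nat \<Rightarrow> nat \<Rightarrow> (nat \<Rightarrow> nat) set" where
  "wick_perms n m = {b. b permutes {1..2 * n} \<and>
    strict_mono_on {1..2 * m} b \<and>
    (\<forall>j\<in>{m + 1..n}. b (2 * j - 1) < b (2 * j)) \<and>
    strict_mono_on {m + 1..n} (\<lambda>j. b (2 * j - 1))}"

end

(* Fix one of the two parts of every field. Time ordering and normal ordering of the resulting
   word are then products along two linear orders of the same letters, each multiplied by the sign
   of its rearrangement, and the contraction of a pair is the difference of its two ordered
   products. Exchanging two neighbours i, j in the first order changes the ordered product by their
   bracket times the ordered product without i and j; in the sum over partial matchings it changes
   only the contraction of {i, j}, hence only the terms in which i and j are matched. So both sides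
   change alike by induction on the number of letters, and they agree when the two orders coincide,
   because all contractions vanish there. Normal ordered products and contractions are sums over the
   choices of parts of the letters that they contain, so summing over all choices factorises. For
   fixed parts neither order depends on the labels, which enter only through signs; this is why no
   symmetry of the normal ordered products is needed. *)

theory Submission
  imports Defs "HOL-Library.Product_Lexorder" "HOL-Library.FuncSet"
begin

section \<open>Signs of lists\<close>

definition swap_sign :: "complex \<Rightarrow> nat \<Rightarrow> nat \<Rightarrow> complex" where
  "swap_sign \<sigma> a b = (if a < b then 1 else \<sigma>)"

text \<open>For distinct letters this is \<open>\<sigma>\<close> raised to the number of inversions,
  hence the signature relative to the increasing order when \<open>\<sigma>\<close> is -1. The
  recursive product splits along appends.\<close>

fun list_sign :: "complex \<Rightarrow> nat list \<Rightarrow> complex" where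
  "list_sign \<sigma> [] = 1"
| "list_sign \<sigma> (x # xs) = (\<Prod>y\<leftarrow>xs. swap_sign \<sigma> x y) * list_sign \<sigma> xs"

lemma swap_sign_flip: "\<sigma> * \<sigma> = 1 \<Longrightarrow> a \<noteq> b \<Longrightarrow> swap_sign \<sigma> a b = \<sigma> * swap_sign \<sigma> b a"
  by (auto simp: swap_sign_def)

lemma prod_list_map_mult:
  fixes f g :: "'b \<Rightarrow> 'c::comm_monoid_mult"
  shows "(\<Prod>x\<leftarrow>xs. f x * g x) = (\<Prod>x\<leftarrow>xs. f x) * (\<Prod>x\<leftarrow>xs. g x)"
  by (induction xs) (simp_all add: mult_ac)

lemma prod_list_map_one:
  fixes f :: "'b \<Rightarrow> 'c::monoid_mult"
  shows "(\<And>x. x \<in> set xs \<Longrightarrow> f x = 1) \<Longrightarrow> prod_list (map f xs) = 1"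
  by (induction xs) simp_all

lemma list_sign_append:
  "list_sign \<sigma> (xs @ ys) =
    list_sign \<sigma> xs * list_sign \<sigma> ys * (\<Prod>x\<leftarrow>xs. \<Prod>y\<leftarrow>ys. swap_sign \<sigma> x y)"
  by (induction xs) (auto simp: mult_ac)

lemma list_sign_sorted: "sorted_wrt (<) xs \<Longrightarrow> list_sign \<sigma> xs = 1"
proof (induction xs)
  case (Cons x xs)
  have "(\<Prod>y\<leftarrow>xs. swap_sign \<sigma> x y) = 1"
    using Cons.prems by (intro prod_list_map_one) (auto simp: swap_sign_def)
  with Cons show ?case by simp
qed simp

text \<open>Only the factor of the pair \<open>i\<close>, \<open>j\<close> changes; every other pair
  of letters keeps its relative order.\<close>

lemma list_sign_swap:
  assumes "\<sigma> * \<sigma> = 1" "i \<noteq> j"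
  shows "list_sign \<sigma> (us @ j # i # vs) = \<sigma> * list_sign \<sigma> (us @ i # j # vs)"
  using swap_sign_flip[OF assms(1), of j i] assms(2)
  by (simp add: list_sign_append prod_list.append mult_ac prod_list_map_mult)

text \<open>Moving both \<open>i\<close> and \<open>j\<close> across a letter \<open>v\<close> costs
  \<open>\<sigma>\<close> twice, and \<open>\<sigma> * \<sigma> = 1\<close>.\<close>

lemma prod_list_swap_sign_flip:
  assumes "\<sigma> * \<sigma> = 1" "i \<notin> set vs" "j \<notin> set vs"
  shows "(\<Prod>v\<leftarrow>vs. swap_sign \<sigma> i v) * (\<Prod>v\<leftarrow>vs. swap_sign \<sigma> j v) =
    (\<Prod>v\<leftarrow>vs. swap_sign \<sigma> v i * swap_sign \<sigma> v j)"
  using assms(2,3)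
proof (induction vs)
  case (Cons v vs)
  have "swap_sign \<sigma> i v * swap_sign \<sigma> j v = \<sigma> * \<sigma> * (swap_sign \<sigma> v i * swap_sign \<sigma> v j)"
    using swap_sign_flip[OF assms(1), of i v] swap_sign_flip[OF assms(1), of j v] Cons.prems
    by auto
  with Cons assms(1) show ?case by (simp add: mult_ac)
qed simp

text \<open>An adjacent pair passes any other letter at no cost, so the factor is a product over the
  set of the other letters and is the same wherever the pair stands. Words and matching lists both
  acquire exactly this factor below.\<close>

lemma list_sign_insert_pair:
  assumes "\<sigma> * \<sigma> = 1" "distinct (us @ i # j # vs)"
  shows "list_sign \<sigma> (us @ i # j # vs) =
    swap_sign \<sigma> i j * (\<Prod>l\<in>set (us @ vs). swap_sign \<sigma> l i * swap_sign \<sigma> l j) *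
      list_sign \<sigma> (us @ vs)"
proof -
  have "(\<Prod>l\<in>set (us @ vs). swap_sign \<sigma> l i * swap_sign \<sigma> l j) =
    (\<Prod>l\<leftarrow>us @ vs. swap_sign \<sigma> l i * swap_sign \<sigma> l j)"
    using assms(2) by (subst prod.distinct_set_conv_list) auto
  also have "\<dots> = (\<Prod>u\<leftarrow>us. swap_sign \<sigma> u i) * (\<Prod>u\<leftarrow>us. swap_sign \<sigma> u j) *
      ((\<Prod>v\<leftarrow>vs. swap_sign \<sigma> i v) * (\<Prod>v\<leftarrow>vs. swap_sign \<sigma> j v))"
    using assms by (subst prod_list_swap_sign_flip) (auto simp: prod_list_map_mult)
  finally show ?thesis
    by (simp add: list_sign_append prod_list_map_mult mult_ac)
qed

section \<open>Adjacent transpositions and the signature of a permutation\<close>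

inductive adjacent_swaps :: "'a list \<Rightarrow> 'a list \<Rightarrow> bool" for xs where
  refl: "adjacent_swaps xs xs"
| step: "adjacent_swaps xs (us @ i # j # vs) \<Longrightarrow> adjacent_swaps xs (us @ j # i # vs)"

lemma adjacent_swaps_trans:
  "adjacent_swaps ys zs \<Longrightarrow> adjacent_swaps xs ys \<Longrightarrow> adjacent_swaps xs zs"
  by (induction rule: adjacent_swaps.induct) (auto intro: adjacent_swaps.intros)

lemma adjacent_swaps_Cons: "adjacent_swaps xs ys \<Longrightarrow> adjacent_swaps (x # xs) (x # ys)"
proof (induction rule: adjacent_swaps.induct)
  case (step us i j vs)
  then show ?case using adjacent_swaps.step[of "x # xs" "x # us" i j vs] by simp
qed (rule adjacent_swaps.refl)

lemma adjacent_swaps_move: "adjacent_swaps (x # us @ vs) (us @ x # vs)"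
proof (induction us)
  case (Cons u us)
  have "adjacent_swaps (x # u # us @ vs) (u # x # us @ vs)"
    using adjacent_swaps.step[OF adjacent_swaps.refl, of "[]" x u "us @ vs"] by simp
  with adjacent_swaps_Cons[OF Cons, of u] show ?case
    by (auto intro: adjacent_swaps_trans)
qed (simp add: adjacent_swaps.refl)

text \<open>The tail is rearranged first, with the head in front; then the head travels to its place
  in \<open>ys\<close>.\<close>

lemma mset_eq_imp_adjacent_swaps: "mset xs = mset ys \<Longrightarrow> adjacent_swaps xs ys"
proof (induction xs arbitrary: ys)
  case (Cons x xs)
  from Cons.prems have "x \<in> set ys" by (metis list.set_intros(1) mset_eq_setD)
  then obtain us vs where ys: "ys = us @ x # vs" by (auto dest: split_list)
  with Cons.prems have "mset xs = mset (us @ vs)" by simp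
  from adjacent_swaps_Cons[OF Cons.IH[OF this]] show ?case
    unfolding ys by (rule adjacent_swaps_trans[OF adjacent_swaps_move])
qed (simp add: adjacent_swaps.refl)

lemma adjacent_swaps_mset: "adjacent_swaps xs ys \<Longrightarrow> mset ys = mset xs"
  by (induction rule: adjacent_swaps.induct) (auto simp: add_mset_commute)

text \<open>Signature and inversion sign both start at 1 and both acquire the factor
  \<open>\<sigma>\<close> at each adjacent swap.\<close>

lemma perm_factor_adjacent:
  assumes "\<sigma> = 1 \<or> \<sigma> = -1" "adjacent_swaps [a..<b] l"
    "p permutes {a..<b}" "map p [a..<b] = l"
  shows "perm_factor \<sigma> p = list_sign \<sigma> l"
  using assms(2-)
proof (induction l arbitrary: p rule: adjacent_swaps.induct)
  case refl
  then have "\<forall>x\<in>{a..<b}. p x = x"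
    by (metis list.map_id map_eq_conv id_apply set_upt)
  with refl.prems(1) have "p = id" by (auto simp: permutes_def fun_eq_iff)
  then show ?case by (simp add: perm_factor_def list_sign_sorted)
next
  case (step us i j vs)
  \<comment> \<open>The entries \<open>j\<close> and \<open>i\<close> sit at the arguments
    \<open>a + length us\<close> and its successor, since the interval starts at \<open>a\<close>.
    Composing \<open>p\<close> with their transposition undoes the last swap.\<close>
  let ?k = "a + length us"
  let ?tr = "Transposition.transpose ?k (Suc ?k)"
  have l: "length (us @ j # i # vs) = b - a"
    using step.prems(2) by (metis length_map length_upt)
  have tr: "?tr permutes {a..<b}"
    using l by (intro permutes_swap_id) auto
  have p: "p (a + r) = (us @ j # i # vs) ! r" if "r < b - a" for r
    using that step.prems(2)[symmetric] by simp
  have "map (p \<circ> ?tr) [a..<b] = us @ i # j # vs"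
  proof (rule nth_equalityI)
    fix r assume r: "r < length (map (p \<circ> ?tr) [a..<b])"
    consider "r = length us" | "r = Suc (length us)" | "r \<noteq> length us" "r \<noteq> Suc (length us)"
      by blast
    then show "map (p \<circ> ?tr) [a..<b] ! r = (us @ i # j # vs) ! r"
    proof cases
      case 1 with r l p[of "Suc r"] show ?thesis by (simp add: nth_append)
    next
      case 2 with r l p[of "length us"] show ?thesis by (simp add: nth_append)
    next
      case 3
      with r l p[of r] show ?thesis
        by (auto simp: nth_append transpose_def nth_Cons split: nat.splits)
    qed
  qed (use l in simp)
  from step.IH[OF permutes_compose[OF tr step.prems(1)] this]
  have IH: "perm_factor \<sigma> (p \<circ> ?tr) = list_sign \<sigma> (us @ i # j # vs)" .
  have "sign (p \<circ> ?tr) = sign p * sign ?tr"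
    using step.prems(1) tr by (intro sign_compose) (auto intro: permutation_permutes[THEN iffD2])
  then have "perm_factor \<sigma> p = \<sigma> * perm_factor \<sigma> (p \<circ> ?tr)"
    using assms(1) by (auto simp: perm_factor_def sign_swap_id)
  moreover have "i \<noteq> j"
    using step.prems permutes_inj_on[OF step.prems(1)]
    by (metis distinct_map distinct_upt distinct_append distinct_length_2_or_more)
  moreover have "\<sigma> * \<sigma> = 1" using assms(1) by auto
  ultimately show ?case using IH list_sign_swap[of \<sigma> i j us vs] by simp
qed

text \<open>Stated for a general interval because it serves twice: for positions counted from 0 and
  for labels counted from 1.\<close>

lemma perm_factor_eq_list_sign:
  assumes "\<sigma> = 1 \<or> \<sigma> = -1" "p permutes {a..<b}"
  shows "perm_factor \<sigma> p = list_sign \<sigma> (map p [a..<b])"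
proof (rule perm_factor_adjacent[OF assms(1) _ assms(2) HOL.refl])
  have "mset (map p [a..<b]) = image_mset p (mset_set {a..<b})" by simp
  also have "\<dots> = mset_set {a..<b}" by (rule permutes_image_mset[OF assms(2)])
  finally show "adjacent_swaps [a..<b] (map p [a..<b])"
    by (intro mset_eq_imp_adjacent_swaps) simp
qed

section \<open>Partial matchings\<close>

lemma sorted_list_of_set_strict_sorted:
  "sorted_wrt (<) xs \<Longrightarrow> sorted_list_of_set (set xs) = xs"
  by (rule strict_sorted_equal) simp_all

definition matchings :: "nat set \<Rightarrow> (nat \<times> nat) set set" where
  "matchings L = {M. M \<subseteq> {(i, j). i < j \<and> i \<in> L \<and> j \<in> L} \<and>
    pairwise (\<lambda>p q. {fst p, snd p} \<inter> {fst q, snd q} = {}) M}"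

definition unmatched :: "nat set \<Rightarrow> (nat \<times> nat) set \<Rightarrow> nat set" where
  "unmatched L M = L - (fst ` M \<union> snd ` M)"

definition flatten_pairs :: "(nat \<times> nat) list \<Rightarrow> nat list" where
  "flatten_pairs ps = concat (map (\<lambda>(i, j). [i, j]) ps)"

text \<open>Pairs of naturals are sorted lexicographically, so for a matching, whose pairs have distinct
  first components, \<open>matching_list\<close> lists the values of the permutation \<open>b\<close> of Wick's theorem.\<close>

definition matching_list :: "nat set \<Rightarrow> (nat \<times> nat) set \<Rightarrow> nat list" where
  "matching_list L M =
    sorted_list_of_set (unmatched L M) @ flatten_pairs (sorted_list_of_set M)"

lemma flatten_pairs_simps [simp]:
  "flatten_pairs [] = []"
  "flatten_pairs (p # ps) = fst p # snd p # flatten_pairs ps"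
  "flatten_pairs (ps @ qs) = flatten_pairs ps @ flatten_pairs qs"
  by (auto simp: flatten_pairs_def split: prod.splits)

lemma set_flatten_pairs: "set (flatten_pairs ps) = fst ` set ps \<union> snd ` set ps"
  by (induction ps) auto

lemma matchings_subset: "matchings L \<subseteq> Pow (L \<times> L)"
  by (auto simp: matchings_def)

lemma finite_matchings: "finite L \<Longrightarrow> finite (matchings L)"
  by (rule finite_subset[OF matchings_subset]) auto

lemma finite_matching: "finite L \<Longrightarrow> M \<in> matchings L \<Longrightarrow> finite M"
  by (rule finite_subset[of M "L \<times> L"]) (auto simp: matchings_def)

lemma empty_in_matchings: "{} \<in> matchings L"
  by (simp add: matchings_def)

text \<open>Together with \<open>matchings_remove\<close> this gives the bijection between the
  matchings of \<open>L\<close> that contain \<open>(i, j)\<close> and all matchings of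
  \<open>L - {i, j}\<close>, on which the induction over letters rests.\<close>

lemma matchings_insert:
  assumes "M \<in> matchings (L - {i, j})" "i < j" "i \<in> L" "j \<in> L"
  shows "insert (i, j) M \<in> matchings L"
  using assms unfolding matchings_def pairwise_insert mem_Collect_eq
  by (intro conjI ballI impI) fastforce+

lemma matching_notin: "M \<in> matchings (L - {i, j}) \<Longrightarrow> (i, j) \<notin> M"
  by (auto simp: matchings_def)

lemma matchings_remove:
  assumes "M \<in> matchings L" "(i, j) \<in> M"
  shows "M - {(i, j)} \<in> matchings (L - {i, j})"
proof -
  have sub: "M \<subseteq> {(i, j). i < j \<and> i \<in> L \<and> j \<in> L}"
    and pw: "pairwise (\<lambda>p q. {fst p, snd p} \<inter> {fst q, snd q} = {}) M"
    using assms(1) by (auto simp: matchings_def)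
  have "fst p \<in> L - {i, j} \<and> snd p \<in> L - {i, j} \<and> fst p < snd p" if "p \<in> M" "p \<noteq> (i, j)" for p
    using pairwiseD[OF pw that(1) assms(2) that(2)] subsetD[OF sub that(1)] by auto
  then have "M - {(i, j)} \<subseteq> {(k, l). k < l \<and> k \<in> L - {i, j} \<and> l \<in> L - {i, j}}"
    by fastforce
  with pairwise_subset[OF pw, of "M - {(i, j)}"] show ?thesis
    unfolding matchings_def by blast
qed

lemma unmatched_insert: "unmatched L (insert (i, j) M) = unmatched (L - {i, j}) M"
  by (auto simp: unmatched_def)

lemma matching_pairs_subset: "M \<in> matchings L \<Longrightarrow> fst ` M \<union> snd ` M \<subseteq> L"
  by (auto simp: matchings_def)

lemma set_matching_list:
  "finite L \<Longrightarrow> M \<in> matchings L \<Longrightarrow> set (matching_list L M) = L"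
  using matching_pairs_subset[of M L]
  by (auto simp: matching_list_def set_flatten_pairs finite_matching unmatched_def)

text \<open>The new pair enters the sorted list of pairs as one block, so its two entries stay
  adjacent, and the list of unmatched letters is the same on both sides.\<close>

lemma matching_list_insert:
  assumes "finite L" "M \<in> matchings (L - {i, j})"
  obtains us vs where "matching_list L (insert (i, j) M) = us @ i # j # vs"
    "matching_list (L - {i, j}) M = us @ vs"
proof -
  let ?ps = "sorted_list_of_set M"
  have "finite M" using assms finite_matching by blast
  then have "sorted_list_of_set (insert (i, j) M) = insort (i, j) ?ps"
    using matching_notin[OF assms(2)] by (rule sorted_list_of_set_insert)
  moreover obtain us vs where "insort (i, j) ?ps = us @ (i, j) # vs" "?ps = us @ vs"
  proof -
    have "\<exists>us vs. insort a ps = us @ a # vs \<and> ps = us @ vs" for a :: "nat \<times> nat" and ps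
    proof (induction ps)
      case (Cons p ps)
      then obtain us vs where "insort a ps = us @ a # vs" "ps = us @ vs" by blast
      then have "insort a (p # ps) = (if a \<le> p then [] @ a # p # ps else (p # us) @ a # vs)"
        "p # ps = [] @ p # ps" "p # ps = (p # us) @ vs"
        by auto
      then show ?case by metis
    qed simp
    then show ?thesis using that by blast
  qed
  ultimately show ?thesis
    using that[of "sorted_list_of_set (unmatched (L - {i, j}) M) @ flatten_pairs us"
        "flatten_pairs vs"]
    by (simp add: matching_list_def unmatched_insert)
qed

lemma distinct_matching_list:
  assumes "finite L" "M \<in> matchings L"
  shows "distinct (matching_list L M)"
proof -
  have "finite M" using assms by (rule finite_matching)
  then show ?thesis using assms
  proof (induction M arbitrary: L rule: finite_induct)
    case empty
    then show ?case by (simp add: matching_list_def)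
  next
    case (insert p M)
    obtain i j where p: "p = (i, j)" by fastforce
    with insert.prems insert.hyps have M: "M \<in> matchings (L - {i, j})"
      using matchings_remove[of "insert p M" L i j] by simp
    from p insert.prems have ij: "i < j" by (auto simp: matchings_def)
    obtain us vs where 1: "matching_list L (insert (i, j) M) = us @ i # j # vs"
      and 2: "matching_list (L - {i, j}) M = us @ vs"
      using matching_list_insert[OF insert.prems(1) M] .
    from 2 insert.IH[OF _ M] insert.prems(1) have "distinct (us @ vs)" by simp
    moreover have "set (us @ vs) = L - {i, j}"
      using 2 set_matching_list[OF _ M] insert.prems(1) by simp
    ultimately show ?case using 1 ij p by auto
  qed
qed

text \<open>The pair is an adjacent block, so this is \<open>list_sign_insert_pair\<close>; the
  factor of the pair itself is 1 because \<open>i < j\<close>.\<close>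

lemma list_sign_matching_list_insert:
  assumes "\<sigma> * \<sigma> = 1" "finite L" "M \<in> matchings (L - {i, j})" "i < j" "i \<in> L" "j \<in> L"
  shows "list_sign \<sigma> (matching_list L (insert (i, j) M)) =
    (\<Prod>l\<in>L - {i, j}. swap_sign \<sigma> l i * swap_sign \<sigma> l j) *
      list_sign \<sigma> (matching_list (L - {i, j}) M)"
proof -
  obtain us vs where 1: "matching_list L (insert (i, j) M) = us @ i # j # vs"
    and 2: "matching_list (L - {i, j}) M = us @ vs"
    using matching_list_insert[OF assms(2,3)] .
  have "distinct (us @ i # j # vs)"
    using distinct_matching_list[OF assms(2) matchings_insert[OF assms(3-6)]] 1 by simp
  moreover have "set (us @ vs) = L - {i, j}"
    using 2 set_matching_list[OF _ assms(3)] assms(2) by simp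
  ultimately show ?thesis
    using list_sign_insert_pair[OF assms(1), of us i j vs] 1 2 assms(4)
    by (simp add: swap_sign_def)
qed

lemma filter_pair:
  assumes "distinct as" "i \<noteq> j" "i \<in> set as" "j \<in> set as"
  shows "filter (\<lambda>l. l \<in> {i, j}) as = [i, j] \<or> filter (\<lambda>l. l \<in> {i, j}) as = [j, i]"
proof -
  let ?f = "filter (\<lambda>l. l \<in> {i, j}) as"
  have d: "distinct ?f" and s: "set ?f = {i, j}" using assms by auto
  then have "length ?f = 2" using assms(2) distinct_card[OF d] by simp
  then obtain a b where f: "?f = [a, b]" by (auto simp: length_Suc_conv numeral_2_eq_2)
  have "{a, b} = {i, j}" using s unfolding f by simp
  then show ?thesis unfolding f by (auto simp: doubleton_eq_iff)
qed

section \<open>Change of order in a word with fixed parts\<close>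

context complex_algebra
begin

text \<open>The list \<open>as\<close> serves as a linear order: the letters of \<open>S\<close> are
  multiplied along it, with the sign of that arrangement relative to the increasing order. One
  notion thus covers time ordering, normal ordering and the restrictions of both to subsets.\<close>

definition ordered_prod :: "complex \<Rightarrow> (nat \<Rightarrow> 'a) \<Rightarrow> nat list \<Rightarrow> nat set \<Rightarrow> 'a" where
  "ordered_prod \<sigma> x as S =
    scale (list_sign \<sigma> (filter (\<lambda>l. l \<in> S) as)) (prod_list (map x (filter (\<lambda>l. l \<in> S) as)))"

text \<open>Contractions enter as complex numbers, so that a product over a set of pairs is
  meaningful without fixing an order of the factors. The value is arbitrary if \<open>y\<close> is
  not a c-number.\<close>

definition c_value :: "'a \<Rightarrow> complex" where
  "c_value y = (SOME c. y = scale c 1)"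

text \<open>The contraction of a pair with respect to two arbitrary orders; later \<open>as\<close>
  is the time order and \<open>bs\<close> the normal order.\<close>

definition pair_coeff ::
  "complex \<Rightarrow> (nat \<Rightarrow> 'a) \<Rightarrow> nat list \<Rightarrow> nat list \<Rightarrow> nat \<times> nat \<Rightarrow> complex" where
  "pair_coeff \<sigma> x as bs p =
    c_value (ordered_prod \<sigma> x as {fst p, snd p} - ordered_prod \<sigma> x bs {fst p, snd p})"

definition wick_sum :: "complex \<Rightarrow> (nat \<Rightarrow> 'a) \<Rightarrow> nat list \<Rightarrow> nat list \<Rightarrow> nat set \<Rightarrow> 'a" where
  "wick_sum \<sigma> x as bs L =
    (\<Sum>M\<in>matchings L. scale (list_sign \<sigma> (matching_list L M) * (\<Prod>p\<in>M. pair_coeff \<sigma> x as bs p))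
      (ordered_prod \<sigma> x bs (unmatched L M)))"

text \<open>\<open>c_value\<close> is additive only if \<open>1 \<noteq> 0\<close>; the zero algebra is treated separately below.\<close>

lemma scale_c_value: "c_number scale y \<Longrightarrow> scale (c_value y) 1 = y"
  unfolding c_number_def c_value_def by (rule someI_ex[THEN sym])

lemma c_value_scale:
  assumes "(1::'a) \<noteq> 0"
  shows "c_value (scale c 1) = c"
  unfolding c_value_def using assms by (intro some_equality) auto

lemma c_number_scale: "c_number scale y \<Longrightarrow> c_number scale (scale a y)"
  by (auto simp: c_number_def)

lemma ordered_prod_pair:
  assumes "\<sigma> * \<sigma> = 1" "distinct as" "i < j" "i \<in> set as" "j \<in> set as"
  shows "ordered_prod \<sigma> x as {i, j} \<in> {x i * x j, scale \<sigma> (x j * x i)}"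
  using filter_pair[OF assms(2), of i j] assms
  by (auto simp: ordered_prod_def swap_sign_def)

text \<open>Either the two orders agree on \<open>i\<close> and \<open>j\<close>, and the ordered
  products coincide, or they disagree, and the products differ by plus or minus the bracket. Each
  case is a c-number.\<close>

lemma scale_pair_coeff:
  assumes "\<sigma> * \<sigma> = 1" "i < j"
    and "distinct as" "i \<in> set as" "j \<in> set as"
    and "distinct bs" "i \<in> set bs" "j \<in> set bs"
    and "c_number scale (bracket scale \<sigma> (x i) (x j))"
  shows "scale (pair_coeff \<sigma> x as bs (i, j)) 1 =
    ordered_prod \<sigma> x as {i, j} - ordered_prod \<sigma> x bs {i, j}"
proof -
  let ?b = "bracket scale \<sigma> (x i) (x j)"
  have "ordered_prod \<sigma> x as {i, j} - ordered_prod \<sigma> x bs {i, j} \<in> {0, ?b, scale (-1) ?b}"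
    using ordered_prod_pair[OF assms(1,3,2,4,5), of x] ordered_prod_pair[OF assms(1,6,2,7,8), of x]
    by (auto simp: bracket_def)
  moreover have "c_number scale 0" by (metis c_number_def scale_zero_left)
  ultimately have "c_number scale (ordered_prod \<sigma> x as {i, j} - ordered_prod \<sigma> x bs {i, j})"
    using assms(9) c_number_scale[of ?b "-1"] by (elim insertE emptyE) simp_all
  then show ?thesis by (simp add: pair_coeff_def scale_c_value)
qed

lemma ordered_prod_filter:
  "S \<subseteq> L \<Longrightarrow> ordered_prod \<sigma> x (filter (\<lambda>l. l \<in> L) as) S = ordered_prod \<sigma> x as S"
proof -
  assume "S \<subseteq> L"
  then have "filter (\<lambda>l. l \<in> S) (filter (\<lambda>l. l \<in> L) as) = filter (\<lambda>l. l \<in> S) as"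
    unfolding filter_filter by (intro filter_cong) auto
  then show ?thesis by (simp only: ordered_prod_def)
qed

text \<open>With equal orders every coefficient is 0, so only the empty matching survives.\<close>

lemma wick_sum_same:
  assumes "distinct bs" "set bs = L" and one: "(1::'a) \<noteq> 0"
  shows "wick_sum \<sigma> x bs bs L = ordered_prod \<sigma> x bs L"
proof -
  have "c_value 0 = 0" using c_value_scale[OF one, of 0] by simp
  then have zero: "pair_coeff \<sigma> x bs bs p = 0" for p by (simp add: pair_coeff_def)
  have fin: "finite L" using assms by auto
  have "wick_sum \<sigma> x bs bs L = (\<Sum>M\<in>{{}}.
      scale (list_sign \<sigma> (matching_list L M) * (\<Prod>p\<in>M. pair_coeff \<sigma> x bs bs p))
      (ordered_prod \<sigma> x bs (unmatched L M)))"
    unfolding wick_sum_def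
  proof (rule sum.mono_neutral_right)
    show "\<forall>M\<in>matchings L - {{}}.
      scale (list_sign \<sigma> (matching_list L M) * (\<Prod>p\<in>M. pair_coeff \<sigma> x bs bs p))
      (ordered_prod \<sigma> x bs (unmatched L M)) = 0"
    proof
      fix M assume "M \<in> matchings L - {{}}"
      then have "finite M" "M \<noteq> {}" using finite_matching[OF fin] by auto
      then have "(\<Prod>p\<in>M. pair_coeff \<sigma> x bs bs p) = 0" by (simp add: zero card_gt_0_iff)
      then show "scale (list_sign \<sigma> (matching_list L M) * (\<Prod>p\<in>M. pair_coeff \<sigma> x bs bs p))
        (ordered_prod \<sigma> x bs (unmatched L M)) = 0" by simp
    qed
  qed (use fin in \<open>auto simp: finite_matchings empty_in_matchings\<close>)
  also have "\<dots> = ordered_prod \<sigma> x bs L"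
    using fin by (simp add: unmatched_def matching_list_def list_sign_sorted)
  finally show ?thesis .
qed

text \<open>Exchanging neighbours replaces \<open>x i * x j\<close> by \<open>\<sigma>\<close> times
  \<open>x j * x i\<close> plus the scalar \<open>c\<close>, and the scalar term leaves the word
  without the pair. The remaining sign is the factor of
  \<open>list_sign_insert_pair\<close>.\<close>

lemma ordered_prod_swap_diff:
  assumes "\<sigma> * \<sigma> = 1" "distinct (us @ i # j # vs)" "i < j"
    and L: "L = set (us @ i # j # vs)"
    and c: "bracket scale \<sigma> (x i) (x j) = scale c 1"
  shows "ordered_prod \<sigma> x (us @ i # j # vs) L - ordered_prod \<sigma> x (us @ j # i # vs) L =
    scale (c * (\<Prod>l\<in>L - {i, j}. swap_sign \<sigma> l i * swap_sign \<sigma> l j))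
      (ordered_prod \<sigma> x (us @ vs) (L - {i, j}))"
proof -
  let ?e = "list_sign \<sigma> (us @ i # j # vs)"
  let ?P = "\<lambda>us. prod_list (map x us)"
  have f: "filter (\<lambda>l. l \<in> L) us = us" "filter (\<lambda>l. l \<in> L) vs = vs" "i \<in> L" "j \<in> L"
    "filter (\<lambda>l. l \<in> L - {i, j}) us = us" "filter (\<lambda>l. l \<in> L - {i, j}) vs = vs"
    using assms(2) by (auto simp: L intro!: filter_True)
  have L': "L - {i, j} = set (us @ vs)" using assms(2) by (auto simp: L)
  have e: "?e = (\<Prod>l\<in>L - {i, j}. swap_sign \<sigma> l i * swap_sign \<sigma> l j) * list_sign \<sigma> (us @ vs)"
    using list_sign_insert_pair[OF assms(1,2)] assms(3) unfolding L' by (simp add: swap_sign_def[of \<sigma> i j])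
  have o: "ordered_prod \<sigma> x (us @ vs) (L - {i, j}) = scale (list_sign \<sigma> (us @ vs)) (?P us * ?P vs)"
    unfolding ordered_prod_def filter_append f by simp
  have xx: "x i * x j = scale \<sigma> (x j * x i) + scale c 1"
    using c by (simp add: bracket_def algebra_simps)
  have "ordered_prod \<sigma> x (us @ i # j # vs) L = scale ?e (?P us * ((x i * x j) * ?P vs))"
    using f by (simp add: ordered_prod_def mult.assoc)
  also have "\<dots> = scale ?e (scale \<sigma> (?P us * x j * x i * ?P vs) + scale c (?P us * ?P vs))"
    unfolding xx by (simp add: distrib_left distrib_right scale_mult_left scale_mult_right mult.assoc)
  \<comment> \<open>Here \<open>?e * \<sigma>\<close> is the sign of the word with \<open>i\<close>
    and \<open>j\<close> exchanged, by \<open>list_sign_swap\<close>.\<close>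
  also have "\<dots> = ordered_prod \<sigma> x (us @ j # i # vs) L + scale (?e * c) (?P us * ?P vs)"
    using f list_sign_swap[OF assms(1), of i j us vs] assms(3)
    by (simp add: ordered_prod_def mult.assoc scale_right_distrib mult.commute[of \<sigma>])
  also have "scale (?e * c) (?P us * ?P vs) =
    scale (c * (\<Prod>l\<in>L - {i, j}. swap_sign \<sigma> l i * swap_sign \<sigma> l j))
      (ordered_prod \<sigma> x (us @ vs) (L - {i, j}))"
    by (simp only: o e) (simp add: mult_ac)
  finally show ?thesis by simp
qed

text \<open>The counterpart of \<open>ordered_prod_swap_diff\<close> with the same prefactor, so
  that the identity for fewer letters makes the two differences equal. Only matchings through
  \<open>(i, j)\<close> contribute, and deleting that pair yields the matchings of the other
  letters.\<close>

lemma wick_sum_swap_diff: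
  assumes "\<sigma> * \<sigma> = 1" "distinct (us @ i # j # vs)" "i < j" and one: "(1::'a) \<noteq> 0"
    and L: "L = set (us @ i # j # vs)" and bs: "distinct bs" "set bs = L"
    and c: "bracket scale \<sigma> (x i) (x j) = scale c 1"
  shows "wick_sum \<sigma> x (us @ i # j # vs) bs L - wick_sum \<sigma> x (us @ j # i # vs) bs L =
    scale (c * (\<Prod>l\<in>L - {i, j}. swap_sign \<sigma> l i * swap_sign \<sigma> l j))
      (wick_sum \<sigma> x (us @ vs) (filter (\<lambda>l. l \<in> L - {i, j}) bs) (L - {i, j}))"
proof -
  let ?as = "us @ i # j # vs" and ?as' = "us @ j # i # vs" and ?L = "L - {i, j}"
  let ?bs = "filter (\<lambda>l. l \<in> ?L) bs"
  let ?s = "\<Prod>l\<in>?L. swap_sign \<sigma> l i * swap_sign \<sigma> l j"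
  define d where "d = pair_coeff \<sigma> x ?as bs"
  define d' where "d' = pair_coeff \<sigma> x ?as' bs"
  define \<epsilon> where "\<epsilon> = (\<lambda>L M. list_sign \<sigma> (matching_list L M))"
  define B where "B = (\<lambda>M. ordered_prod \<sigma> x bs (unmatched L M))"
  have fin: "finite L" using L by simp
  have ij: "i \<in> L" "j \<in> L" using L by auto
  \<comment> \<open>Any other pair of a matching contains at most one of \<open>i\<close>,
    \<open>j\<close>, so both words restrict to the same list on it.\<close>
  have d_same: "d p = d' p" if "M \<in> matchings L" "p \<in> M" "p \<noteq> (i, j)" for p M
  proof -
    from that have "\<not> (i \<in> {fst p, snd p} \<and> j \<in> {fst p, snd p})"
      using \<open>i < j\<close> by (cases p) (auto simp: matchings_def)
    then have "filter (\<lambda>l. l \<in> {fst p, snd p}) ?as = filter (\<lambda>l. l \<in> {fst p, snd p}) ?as'"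
      by auto
    then show ?thesis by (simp only: d_def d'_def pair_coeff_def ordered_prod_def)
  qed
  have d_sub: "pair_coeff \<sigma> x (us @ vs) ?bs p = d p" if "M \<in> matchings ?L" "p \<in> M" for p M
  proof -
    from that have "{fst p, snd p} \<subseteq> ?L" by (auto simp: matchings_def)
    moreover from this have "ordered_prod \<sigma> x ?as {fst p, snd p} =
      ordered_prod \<sigma> x (us @ vs) {fst p, snd p}"
      by (auto simp: ordered_prod_def)
    ultimately show ?thesis by (simp only: d_def pair_coeff_def ordered_prod_filter)
  qed
  \<comment> \<open>The \<open>bs\<close> terms cancel, and the bracket of \<open>x i\<close> and
    \<open>x j\<close> remains. Since \<open>1\<close> is not \<open>0\<close>, the equation between
    operators becomes one between scalars.\<close>
  have d_ij: "d (i, j) - d' (i, j) = c"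
  proof -
    have f: "filter (\<lambda>l. l \<in> {i, j}) us = []" "filter (\<lambda>l. l \<in> {i, j}) vs = []"
      using assms(2) by (auto simp: filter_empty_conv)
    have cn: "c_number scale (bracket scale \<sigma> (x i) (x j))"
      using c by (auto simp: c_number_def)
    have "scale (d (i, j)) 1 = ordered_prod \<sigma> x ?as {i, j} - ordered_prod \<sigma> x bs {i, j}"
      unfolding d_def using assms(1-3) bs ij cn by (intro scale_pair_coeff) auto
    moreover have "scale (d' (i, j)) 1 = ordered_prod \<sigma> x ?as' {i, j} - ordered_prod \<sigma> x bs {i, j}"
      unfolding d'_def using assms(1-3) bs ij cn by (intro scale_pair_coeff) auto
    ultimately have "scale (d (i, j) - d' (i, j)) 1 =
      ordered_prod \<sigma> x ?as {i, j} - ordered_prod \<sigma> x ?as' {i, j}"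
      by (simp add: scale_left_diff_distrib)
    also have "\<dots> = scale c 1"
      using f \<open>i < j\<close> c by (simp add: ordered_prod_def swap_sign_def bracket_def)
    finally show ?thesis using one by simp
  qed
  \<comment> \<open>The contribution of a matching through \<open>(i, j)\<close> to the difference:
    the coefficient of \<open>(i, j)\<close> is replaced by \<open>c\<close>.\<close>
  define F where "F = (\<lambda>M. scale (\<epsilon> L M * (c * (\<Prod>p\<in>M - {(i, j)}. d p))) (B M))"
  have "wick_sum \<sigma> x ?as bs L - wick_sum \<sigma> x ?as' bs L =
    (\<Sum>M\<in>matchings L. scale (\<epsilon> L M * ((\<Prod>p\<in>M. d p) - (\<Prod>p\<in>M. d' p))) (B M))"
    by (simp add: wick_sum_def sum_subtractf d_def d'_def \<epsilon>_def B_def right_diff_distrib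
        scale_left_diff_distrib)
  also have "\<dots> = (\<Sum>M\<in>matchings L. if (i, j) \<in> M then F M else 0)"
  proof (rule sum.cong[OF HOL.refl])
    fix M assume M: "M \<in> matchings L"
    have finM: "finite M" using finite_matching[OF fin M] .
    have eq: "(\<Prod>p\<in>M - {(i, j)}. d p) = (\<Prod>p\<in>M - {(i, j)}. d' p)"
      using d_same[OF M] by (intro prod.cong) auto
    show "scale (\<epsilon> L M * ((\<Prod>p\<in>M. d p) - (\<Prod>p\<in>M. d' p))) (B M) = (if (i, j) \<in> M then F M else 0)"
    proof (cases "(i, j) \<in> M")
      case True
      then have "(\<Prod>p\<in>M. d p) - (\<Prod>p\<in>M. d' p) = (d (i, j) - d' (i, j)) * (\<Prod>p\<in>M - {(i, j)}. d p)"
        using finM by (simp add: prod.remove[of M "(i, j)"] eq left_diff_distrib)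
      with True show ?thesis by (simp add: F_def d_ij)
    next
      case False
      with eq show ?thesis by simp
    qed
  qed
  also have "\<dots> = (\<Sum>M\<in>{M \<in> matchings L. (i, j) \<in> M}. F M)"
    using finite_matchings[OF fin] by (simp add: sum.inter_filter)
  also have "\<dots> = (\<Sum>M\<in>matchings ?L. F (insert (i, j) M))"
    using matchings_remove matchings_insert[OF _ \<open>i < j\<close> ij] matching_notin
    by (intro sum.reindex_bij_witness[where i = "insert (i, j)" and j = "\<lambda>M. M - {(i, j)}"])
      (auto simp: insert_absorb)
  also have "\<dots> = (\<Sum>M\<in>matchings ?L. scale (c * ?s) (scale (\<epsilon> ?L M *
      (\<Prod>p\<in>M. pair_coeff \<sigma> x (us @ vs) ?bs p)) (ordered_prod \<sigma> x ?bs (unmatched ?L M))))"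
  proof (rule sum.cong[OF HOL.refl])
    fix M assume M: "M \<in> matchings ?L"
    \<comment> \<open>Inserting the pair into the matching list produces the same sign factor
      \<open>?s\<close> as inserting it into the word.\<close>
    have "\<epsilon> L (insert (i, j) M) = ?s * \<epsilon> ?L M"
      unfolding \<epsilon>_def by (rule list_sign_matching_list_insert[OF assms(1) fin M \<open>i < j\<close> ij])
    moreover have "insert (i, j) M - {(i, j)} = M" using matching_notin[OF M] by simp
    moreover have "(\<Prod>p\<in>M. pair_coeff \<sigma> x (us @ vs) ?bs p) = (\<Prod>p\<in>M. d p)"
      using d_sub[OF M] by (intro prod.cong) auto
    moreover have "ordered_prod \<sigma> x ?bs (unmatched ?L M) = B (insert (i, j) M)"
      unfolding B_def unmatched_insert by (rule ordered_prod_filter) (auto simp: unmatched_def)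
    ultimately show "F (insert (i, j) M) = scale (c * ?s) (scale (\<epsilon> ?L M *
      (\<Prod>p\<in>M. pair_coeff \<sigma> x (us @ vs) ?bs p)) (ordered_prod \<sigma> x ?bs (unmatched ?L M)))"
      by (simp add: F_def mult_ac)
  qed
  also have "\<dots> = scale (c * ?s) (wick_sum \<sigma> x (us @ vs) ?bs ?L)"
    by (simp only: wick_sum_def \<epsilon>_def scale_sum_right)
  finally show ?thesis .
qed

text \<open>Two nested inductions: the outer one, on the length, supplies the identity for the word
  without an adjacent pair; the inner one walks from \<open>bs\<close> to \<open>as\<close> by
  adjacent swaps.\<close>

theorem ordered_prod_eq_wick_sum:
  assumes "\<sigma> * \<sigma> = 1" and one: "(1::'a) \<noteq> 0"
    and "distinct as" "set as = L" "distinct bs" "set bs = L"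
    and "\<And>i j. i \<in> L \<Longrightarrow> j \<in> L \<Longrightarrow> i \<noteq> j \<Longrightarrow> c_number scale (bracket scale \<sigma> (x i) (x j))"
  shows "ordered_prod \<sigma> x as L = wick_sum \<sigma> x as bs L"
  using assms(3-)
proof (induction "length as" arbitrary: as bs L rule: less_induct)
  case less
  let ?Q = "\<lambda>as. ordered_prod \<sigma> x as L = wick_sum \<sigma> x as bs L"
  \<comment> \<open>Both sides change by the same amount, so the identity passes across the swap in
    either direction. The equivalence also covers swaps that start from the decreasing pair.\<close>
  have swap: "?Q (us @ i # j # vs) \<longleftrightarrow> ?Q (us @ j # i # vs)"
    if "mset (us @ i # j # vs) = mset as" "i < j" for us i j vs
  proof -
    from that(1) less.prems have d: "distinct (us @ i # j # vs)" and L: "L = set (us @ i # j # vs)"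
      by (metis mset_eq_imp_distinct_iff) (metis less.prems(2) mset_eq_setD that(1))
    let ?L = "L - {i, j}"
    obtain c where c: "bracket scale \<sigma> (x i) (x j) = scale c 1"
      using less.prems(5)[of i j] \<open>i < j\<close> L by (auto simp: c_number_def)
    have "length (us @ vs) < length as"
      using that(1)[THEN mset_eq_length] by simp
    moreover have "set (us @ vs) = ?L" using d L by auto
    ultimately have "ordered_prod \<sigma> x (us @ vs) ?L =
      wick_sum \<sigma> x (us @ vs) (filter (\<lambda>l. l \<in> ?L) bs) ?L"
      using d less.prems by (intro less.hyps) auto
    with ordered_prod_swap_diff[OF assms(1) d \<open>i < j\<close> L c]
      wick_sum_swap_diff[OF assms(1) d \<open>i < j\<close> one L less.prems(3,4) c]
    have "ordered_prod \<sigma> x (us @ i # j # vs) L - ordered_prod \<sigma> x (us @ j # i # vs) L =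
      wick_sum \<sigma> x (us @ i # j # vs) bs L - wick_sum \<sigma> x (us @ j # i # vs) bs L"
      by simp
    moreover have "a - b = c - d \<Longrightarrow> a = c \<longleftrightarrow> b = d" for a b c d :: 'a
      by (auto simp: algebra_simps)
    ultimately show ?thesis by blast
  qed
  have ms: "mset bs = mset as"
    using less.prems by (metis set_eq_iff_mset_eq_distinct)
  have "?Q l" if "adjacent_swaps bs l" for l
    using that
  proof (induction l rule: adjacent_swaps.induct)
    case refl
    then show ?case using wick_sum_same[OF less.prems(3,4) one] by simp
  next
    case (step us i j vs)
    from step.hyps have m: "mset (us @ i # j # vs) = mset as"
      using ms by (simp only: adjacent_swaps_mset)
    then have "i \<noteq> j"
      using less.prems(1) by (metis distinct_append distinct_length_2_or_more mset_eq_imp_distinct_iff)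
    then consider "i < j" | "j < i" by linarith
    then show ?case
    proof cases
      case 1 with swap[OF m] step.IH show ?thesis by simp
    next
      case 2
      moreover have "mset (us @ j # i # vs) = mset as" using m by (simp add: add_mset_commute)
      ultimately show ?thesis using swap[of us j i vs] step.IH by simp
    qed
  qed
  with ms show ?case by (blast intro: mset_eq_imp_adjacent_swaps)
qed

end

section \<open>Choices of parts\<close>

text \<open>Extensional functions, so that each choice of parts on \<open>S\<close> is counted
  exactly once.\<close>

definition choices :: "nat set \<Rightarrow> (nat \<Rightarrow> part) set" where
  "choices S = S \<rightarrow>\<^sub>E {Pos, Neg}"

text \<open>For fixed parts, the linear order along which normal ordering multiplies.\<close>

definition normal_list :: "(nat \<Rightarrow> part) \<Rightarrow> nat list \<Rightarrow> nat list" where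
  "normal_list e as = filter (\<lambda>l. e l = Neg) as @ filter (\<lambda>l. e l = Pos) as"

lemma set_normal_list [simp]: "set (normal_list e as) = set as"
  by (auto simp: normal_list_def) (metis part.exhaust)

lemma distinct_normal_list: "distinct as \<Longrightarrow> distinct (normal_list e as)"
  by (auto simp: normal_list_def)

text \<open>Consequently the normal order of any subset of letters is the restriction of the normal
  order of the full word.\<close>

lemma normal_list_filter: "filter P (normal_list e as) = normal_list e (filter P as)"
  by (simp add: normal_list_def conj_commute)

lemma normal_list_cong:
  "(\<And>l. l \<in> set as \<Longrightarrow> e l = e' l) \<Longrightarrow> normal_list e as = normal_list e' as"
  unfolding normal_list_def by (intro arg_cong2[where f = append] filter_cong) auto

lemma choices_merge:
  assumes "A \<inter> B = {}" "e1 \<in> choices A" "e2 \<in> choices B"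
  shows "(\<lambda>l. if l \<in> A then e1 l else e2 l) \<in> choices (A \<union> B)"
  using assms by (auto simp: choices_def PiE_iff extensional_def)

lemma choices_restrict: "e \<in> choices L \<Longrightarrow> A \<subseteq> L \<Longrightarrow> restrict e A \<in> choices A"
  by (auto simp: choices_def PiE_iff)

text \<open>Pairs with \<open>k = 0\<close> combine the head with a later entry satisfying
  \<open>Q\<close>; all other pairs are pairs of the tail shifted by one.\<close>

lemma card_inversions_Cons:
  "card {(k, l). k < l \<and> l < length (a # as) \<and> P ((a # as) ! k) \<and> Q ((a # as) ! l)} =
    card {(k, l). k < l \<and> l < length as \<and> P (as ! k) \<and> Q (as ! l)} +
    (if P a then length (filter Q as) else 0)"
proof -
  let ?C = "{(k, l). k < l \<and> l < length as \<and> P (as ! k) \<and> Q (as ! l)}"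
  let ?D = "{l. l < length as \<and> Q (as ! l)}"
  have fin: "finite ?C" by (rule finite_subset[of _ "{..<length as} \<times> {..<length as}"]) auto
  have "{(k, l). k < l \<and> l < length (a # as) \<and> P ((a # as) ! k) \<and> Q ((a # as) ! l)} =
    map_prod Suc Suc ` ?C \<union> (if P a then (\<lambda>l. (0, Suc l)) ` ?D else {})"
    (is "?X = ?Y")
  proof (rule set_eqI)
    fix z :: "nat \<times> nat"
    obtain k l where z: "z = (k, l)" by fastforce
    show "z \<in> ?X \<longleftrightarrow> z \<in> ?Y"
      unfolding z by (cases k; cases l) (auto simp: image_iff)
  qed
  moreover have "card (map_prod Suc Suc ` ?C \<union> (if P a then (\<lambda>l. (0, Suc l)) ` ?D else {})) =
    card ?C + (if P a then card ?D else 0)"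
    using fin by (subst card_Un_disjoint) (auto simp: card_image inj_on_def)
  ultimately show ?thesis by (simp only: length_filter_conv_card)
qed

text \<open>In an increasing word the inversions created by normal ordering are exactly the positive
  symbols standing before negative ones, which gives the exponent in
  \<open>normal_ordered_word\<close>. In the induction the least letter \<open>a\<close> is passed
  by the later negative letters precisely when it is positive.\<close>

lemma list_sign_normal_list:
  assumes "sorted_wrt (<) as"
  shows "list_sign \<sigma> (normal_list e as) =
    \<sigma> ^ card {(k, l). k < l \<and> l < length as \<and> e (as ! k) = Pos \<and> e (as ! l) = Neg}"
  using assms
proof (induction as)
  case (Cons a as)
  let ?neg = "filter (\<lambda>l. e l = Neg) as" and ?pos = "filter (\<lambda>l. e l = Pos) as"
  from Cons.prems have a: "a < l" if "l \<in> set as" for l using that by simp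
  then have one: "(\<Prod>y\<leftarrow>ys. swap_sign \<sigma> a y) = 1" if "set ys \<subseteq> set as" for ys
    using that by (intro prod_list_map_one) (auto simp: swap_sign_def)
  have sigma: "(\<Prod>y\<leftarrow>ys. swap_sign \<sigma> y a) = \<sigma> ^ length ys" if "set ys \<subseteq> set as" for ys
    using that a by (induction ys) (auto simp: swap_sign_def dest: less_asym)
  have "list_sign \<sigma> (normal_list e (a # as)) =
    list_sign \<sigma> (normal_list e as) * \<sigma> ^ (if e a = Pos then length ?neg else 0)"
  proof (cases "e a")
    case Pos
    then have "normal_list e (a # as) = ?neg @ a # ?pos" by (simp add: normal_list_def)
    then show ?thesis using Pos one[of ?pos] sigma[of ?neg]
      by (simp add: normal_list_def list_sign_append prod_list_map_mult)
  next
    case Neg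
    then have "normal_list e (a # as) = a # normal_list e as" by (simp add: normal_list_def)
    then show ?thesis using Neg one[of "normal_list e as"] by simp
  qed
  with Cons show ?case
    by (simp only: card_inversions_Cons[where P = "\<lambda>l. e l = Pos" and Q = "\<lambda>l. e l = Neg"])
      (simp add: power_add)
qed (simp add: normal_list_def)

text \<open>Comparisons alone determine the sign; this transfers it from positions to
  labels.\<close>

lemma list_sign_map:
  assumes "\<And>x y. x \<in> set xs \<Longrightarrow> y \<in> set xs \<Longrightarrow> f x < f y \<longleftrightarrow> x < y"
  shows "list_sign \<sigma> (map f xs) = list_sign \<sigma> xs"
  using assms
proof (induction xs)
  case (Cons x xs)
  have "map (\<lambda>y. swap_sign \<sigma> (f x) (f y)) xs = map (swap_sign \<sigma> x) xs"
    using Cons.prems by (intro map_cong) (auto simp: swap_sign_def)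
  moreover have "list_sign \<sigma> (map f xs) = list_sign \<sigma> xs" using Cons by simp
  ultimately show ?case by (simp only: list.map list_sign.simps map_map o_def)
qed simp

text \<open>Replaces the lists of parts in \<open>normal_ordered\<close> by functions on labels,
  which can be restricted to subsets.\<close>

lemma bij_betw_choices:
  assumes "distinct as"
  shows "bij_betw (\<lambda>e. map e as) (choices (set as)) {es. set es \<subseteq> {Pos, Neg} \<and> length es = length as}"
proof (rule bij_betwI')
  fix e e' assume "e \<in> choices (set as)" "e' \<in> choices (set as)"
  then show "map e as = map e' as \<longleftrightarrow> e = e'"
    unfolding choices_def by (auto intro: PiE_ext)
next
  fix e assume "e \<in> choices (set as)"
  then show "map e as \<in> {es. set es \<subseteq> {Pos, Neg} \<and> length es = length as}"
    by (auto simp: choices_def PiE_iff)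
next
  fix es assume es: "es \<in> {es. set es \<subseteq> {Pos, Neg} \<and> length es = length as}"
  define e where "e = restrict (\<lambda>l. the (map_of (zip as es) l)) (set as)"
  have "map e as = es"
    using es assms by (intro nth_equalityI) (auto simp: e_def map_of_zip_nth)
  moreover have "e \<in> choices (set as)"
  proof -
    have "e l \<in> set es" if "l \<in> set as" for l
      using that \<open>map e as = es\<close> by (metis image_eqI set_map)
    then show ?thesis using es by (auto simp: choices_def PiE_iff e_def)
  qed
  ultimately show "\<exists>e\<in>choices (set as). es = map e as" by blast
qed

section \<open>Time and normal ordering as sums over choices of parts\<close>

context complex_algebra
begin

lemma prod_list_field_op:
  assumes "distinct as"
  shows "prod_list (map (field_op \<psi>) as) =
    (\<Sum>e\<in>choices (set as). prod_list (map (\<lambda>l. \<psi> (e l) l) as) :: 'a)"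
  using assms
proof (induction as)
  case Nil
  then show ?case by (simp add: choices_def)
next
  case (Cons a as)
  let ?P = "\<lambda>e as. prod_list (map (\<lambda>l. \<psi> (e l) l) as)"
  have a: "a \<notin> set as" using Cons.prems by simp
  have "(\<Sum>e\<in>choices (set (a # as)). ?P e (a # as)) =
    (\<Sum>(y, g)\<in>{Pos, Neg} \<times> choices (set as). ?P (g(a := y)) (a # as))"
    unfolding choices_def list.set PiE_insert_eq
    by (subst sum.reindex[OF inj_combinator[OF a]]) (simp add: case_prod_unfold)
  also have "\<dots> = (\<Sum>(y, g)\<in>{Pos, Neg} \<times> choices (set as). \<psi> y a * ?P g as)"
  proof (intro sum.cong HOL.refl)
    fix z :: "part \<times> (nat \<Rightarrow> part)"
    obtain y g where z: "z = (y, g)" by fastforce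
    have "map (\<lambda>l. \<psi> ((g(a := y)) l) l) as = map (\<lambda>l. \<psi> (g l) l) as"
      using a by auto
    then have "?P (g(a := y)) (a # as) = \<psi> y a * ?P g as"
      by (simp only: list.map prod_list.Cons fun_upd_same)
    then show "(case z of (y, g) \<Rightarrow> ?P (g(a := y)) (a # as)) =
      (case z of (y, g) \<Rightarrow> \<psi> y a * ?P g as)"
      by (simp only: z prod.case)
  qed
  also have "\<dots> = (\<Sum>y\<in>{Pos, Neg}. \<psi> y a * (\<Sum>g\<in>choices (set as). ?P g as))"
    by (simp add: sum.cartesian_product[symmetric] sum_distrib_left)
  also have "\<dots> = prod_list (map (field_op \<psi>) (a # as))"
    using Cons by (simp add: field_op_def[of \<psi> a] distrib_right)
  finally show ?case by simp
qed

lemma normal_ordered_eq: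
  assumes "sorted_wrt (<) as"
  shows "normal_ordered scale \<sigma> \<psi> as =
    (\<Sum>e\<in>choices (set as). ordered_prod \<sigma> (\<lambda>l. \<psi> (e l) l) (normal_list e as) (set as))"
proof -
  have "distinct as" using assms strict_sorted_iff by blast
  have "normal_ordered scale \<sigma> \<psi> as =
    (\<Sum>e\<in>choices (set as). normal_ordered_word scale \<sigma> \<psi> (zip (map e as) as))"
    unfolding normal_ordered_def
    by (rule sum.reindex_bij_betw[OF bij_betw_choices[OF \<open>distinct as\<close>], symmetric])
  also have "\<dots> = (\<Sum>e\<in>choices (set as).
      ordered_prod \<sigma> (\<lambda>l. \<psi> (e l) l) (normal_list e as) (set as))"
  proof (rule sum.cong[OF HOL.refl])
    fix e :: "nat \<Rightarrow> part"
    have z: "zip (map e as) as = map (\<lambda>l. (e l, l)) as" by (induction as) auto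
    have S: "{(k, l). k < l \<and> l < length (map (\<lambda>l. (e l, l)) as) \<and>
        fst (map (\<lambda>l. (e l, l)) as ! k) = Pos \<and> fst (map (\<lambda>l. (e l, l)) as ! l) = Neg} =
      {(k, l). k < l \<and> l < length as \<and> e (as ! k) = Pos \<and> e (as ! l) = Neg}"
      by auto
    have f: "filter (\<lambda>l. l \<in> set as) (normal_list e as) = normal_list e as"
      by (rule filter_True) simp
    show "normal_ordered_word scale \<sigma> \<psi> (zip (map e as) as) =
      ordered_prod \<sigma> (\<lambda>l. \<psi> (e l) l) (normal_list e as) (set as)"
      unfolding z normal_ordered_word_def S ordered_prod_def f list_sign_normal_list[OF assms]
      by (simp add: normal_list_def filter_map o_def)
  qed
  finally show ?thesis .
qed

text \<open>For distinct times the defining sum has a single term, the permutation sorting by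
  decreasing time. Since \<open>sort_key\<close> sorts increasingly, its result is reversed.\<close>

lemma time_ordered_eq_prod:
  assumes "\<sigma> = 1 \<or> \<sigma> = -1" "sorted_wrt (<) as" "inj_on t (set as)"
  shows "time_ordered scale \<sigma> t \<psi> as = scale (list_sign \<sigma> (rev (sort_key t as)))
    (prod_list (map (field_op \<psi>) (rev (sort_key t as))) :: 'a)"
proof -
  let ?ta = "rev (sort_key t as)" and ?n = "length as"
  have d: "distinct as" using assms(2) strict_sorted_iff by blast
  have dt: "distinct (map t (sort_key t as))"
    using d assms(3) by (simp add: distinct_map)
  then have ta: "sorted_wrt (<) (map t (sort_key t as))"
    by (simp add: strict_sorted_iff)
  \<comment> \<open>A strictly increasing list of times is determined by its set, and injectivity of
    \<open>t\<close> recovers the labels.\<close>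
  have unique: "map (\<lambda>i. as ! p i) [0..<?n] = ?ta"
    if p: "p permutes {..<?n}" "\<forall>i j. i < j \<and> j < ?n \<longrightarrow> t (as ! p j) < t (as ! p i)" for p
  proof -
    let ?l = "map (\<lambda>i. as ! p i) [0..<?n]"
    have "?l = permute_list p as" by (simp add: permute_list_def)
    then have set_l: "set ?l = set as" using p(1) by (metis set_permute_list)
    have "sorted_wrt (<) (map t (rev ?l))"
      using p(2) by (simp only: rev_map[symmetric] sorted_wrt_rev)
        (simp add: sorted_wrt_iff_nth_less)
    from strict_sorted_equal[OF ta this] have "map t (rev ?l) = map t (sort_key t as)"
      by (simp only: list.set_map[of t] set_rev set_l set_sort)
    moreover have "inj_on t (set (rev ?l) \<union> set (sort_key t as))"
      using assms(3) by (simp only: set_rev set_l set_sort Un_absorb)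
    ultimately have "rev ?l = sort_key t as" by (rule map_inj_on)
    then show ?thesis by (metis rev_rev_ident)
  qed
  obtain p where p: "p permutes {..<?n}" "permute_list p as = ?ta"
    by (metis mset_eq_permutation mset_rev mset_sort)
  then have map_p: "map (\<lambda>i. as ! p i) [0..<?n] = ?ta" by (simp add: permute_list_def)
  have desc: "t (as ! p j) < t (as ! p i)" if "i < j" "j < ?n" for i j
  proof -
    from ta have "sorted_wrt (\<lambda>x y. y < x) (map t ?ta)"
      by (simp only: rev_map[symmetric] sorted_wrt_rev)
    then have "sorted_wrt (\<lambda>x y. y < x) (map (\<lambda>i. t (as ! p i)) [0..<?n])"
      by (simp add: map_p[symmetric] o_def)
    with that show ?thesis by (simp add: sorted_wrt_iff_nth_less)
  qed
  have "{p. p permutes {..<?n} \<and> (\<forall>i j. i < j \<and> j < ?n \<longrightarrow> t (as ! p j) < t (as ! p i))} = {p}"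
  proof (intro equalityI subsetI)
    fix q assume "q \<in> {p. p permutes {..<?n} \<and>
      (\<forall>i j. i < j \<and> j < ?n \<longrightarrow> t (as ! p j) < t (as ! p i))}"
    then have q: "q permutes {..<?n}" "map (\<lambda>i. as ! q i) [0..<?n] = ?ta"
      using unique by auto
    have "q i = p i" for i
    proof (cases "i < ?n")
      case True
      with q(2) map_p have "as ! q i = as ! p i" by (metis map_eq_conv atLeastLessThan_upt atLeast0LessThan lessThan_iff)
      moreover have "q i < ?n" "p i < ?n"
        using True permutes_in_image[OF q(1)] permutes_in_image[OF p(1)] by auto
      ultimately show ?thesis using d by (simp add: nth_eq_iff_index_eq)
    next
      case False
      with q(1) p(1) show ?thesis by (simp add: permutes_def)
    qed
    then show "q \<in> {p}" by auto
  qed (use p(1) desc in auto)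
  \<comment> \<open>Here \<open>perm_factor\<close> refers to positions and \<open>list_sign\<close>
    to labels; the word \<open>as\<close> is increasing, so both compare alike.\<close>
  moreover have "perm_factor \<sigma> p = list_sign \<sigma> ?ta"
  proof -
    have "perm_factor \<sigma> p = list_sign \<sigma> (map p [0..<?n])"
      using p(1) assms(1) by (intro perm_factor_eq_list_sign) (simp_all add: atLeast0LessThan)
    also have "\<dots> = list_sign \<sigma> (map ((!) as) (map p [0..<?n]))"
    proof (rule list_sign_map[symmetric])
      fix k l assume "k \<in> set (map p [0..<?n])" "l \<in> set (map p [0..<?n])"
      then have kl: "k < ?n" "l < ?n"
        by (simp_all add: atLeast0LessThan permutes_image[OF p(1)])
      have mono: "as ! k < as ! l" if "k < l" "l < ?n" for k l
        using sorted_wrt_nth_less[OF assms(2) that] .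
      from mono[of k l] mono[of l k] kl show "as ! k < as ! l \<longleftrightarrow> k < l"
        by (cases k l rule: linorder_cases) auto
    qed
    also have "map ((!) as) (map p [0..<?n]) = ?ta" using map_p by (simp add: o_def)
    finally show ?thesis .
  qed
  moreover have "map (\<lambda>i. field_op \<psi> (as ! p i)) [0..<?n] = map (field_op \<psi>) ?ta"
    unfolding map_p[symmetric] by simp
  ultimately show ?thesis unfolding time_ordered_def by simp
qed

lemma time_ordered_eq:
  assumes "\<sigma> = 1 \<or> \<sigma> = -1" "sorted_wrt (<) as" "inj_on t (set as)"
  shows "time_ordered scale \<sigma> t \<psi> as =
    (\<Sum>e\<in>choices (set as). ordered_prod \<sigma> (\<lambda>l. \<psi> (e l) l) (rev (sort_key t as)) (set as))"
proof -
  let ?ta = "rev (sort_key t as)"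
  have "distinct ?ta" using assms(2) strict_sorted_iff by (metis distinct_rev distinct_sort)
  then have "prod_list (map (field_op \<psi>) ?ta) =
    (\<Sum>e\<in>choices (set as). prod_list (map (\<lambda>l. \<psi> (e l) l) ?ta) :: 'a)"
    using prod_list_field_op[of ?ta \<psi>] by (simp only: set_rev set_sort)
  moreover have "filter (\<lambda>l. l \<in> set as) ?ta = ?ta" by (rule filter_True) simp
  ultimately show ?thesis
    unfolding time_ordered_eq_prod[OF assms] ordered_prod_def by (simp only: scale_sum_right)
qed

section \<open>Factorisation of sums over choices\<close>

lemma sum_choices_union:
  fixes G :: "(nat \<Rightarrow> part) \<Rightarrow> 'a" and H :: "(nat \<Rightarrow> part) \<Rightarrow> complex"
  assumes "A \<inter> B = {}"
    and G: "\<And>e e'. (\<And>l. l \<in> A \<Longrightarrow> e l = e' l) \<Longrightarrow> G e = G e'"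
    and H: "\<And>e e'. (\<And>l. l \<in> B \<Longrightarrow> e l = e' l) \<Longrightarrow> H e = H e'"
  shows "(\<Sum>e\<in>choices (A \<union> B). scale (H e) (G e)) =
    scale (\<Sum>e\<in>choices B. H e) (\<Sum>e\<in>choices A. G e)"
proof -
  have "(\<Sum>e\<in>choices (A \<union> B). scale (H e) (G e)) =
    (\<Sum>(e2, e1)\<in>choices B \<times> choices A. scale (H e2) (G e1))"
  proof (rule sum.reindex_bij_witness[where j = "\<lambda>e. (restrict e B, restrict e A)"
        and i = "\<lambda>(e2, e1) l. if l \<in> A then e1 l else e2 l"])
    fix e assume e: "e \<in> choices (A \<union> B)"
    show "(case (restrict e B, restrict e A) of (e2, e1) \<Rightarrow> \<lambda>l. if l \<in> A then e1 l else e2 l) = e"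
      using e by (auto simp: fun_eq_iff choices_def PiE_iff extensional_def restrict_def)
    show "(restrict e B, restrict e A) \<in> choices B \<times> choices A"
      using e by (auto intro: choices_restrict)
    have "H (restrict e B) = H e" "G (restrict e A) = G e"
      by (rule H G, simp)+
    then show "(case (restrict e B, restrict e A) of (e2, e1) \<Rightarrow> scale (H e2) (G e1)) =
      scale (H e) (G e)"
      by simp
  next
    fix p assume p: "p \<in> choices B \<times> choices A"
    obtain e2 e1 where p': "p = (e2, e1)" by fastforce
    with p have e: "e2 \<in> choices B" "e1 \<in> choices A" by auto
    show "(case p of (e2, e1) \<Rightarrow> \<lambda>l. if l \<in> A then e1 l else e2 l) \<in> choices (A \<union> B)"
      using choices_merge[OF assms(1) e(2,1)] by (simp add: p')
    have "restrict (\<lambda>l. if l \<in> A then e1 l else e2 l) B = e2"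
      using e(1) assms(1) by (intro ext) (auto simp: choices_def PiE_iff extensional_def)
    moreover have "restrict (\<lambda>l. if l \<in> A then e1 l else e2 l) A = e1"
      using e(2) by (intro ext) (auto simp: choices_def PiE_iff extensional_def)
    ultimately show "(restrict (case p of (e2, e1) \<Rightarrow> \<lambda>l. if l \<in> A then e1 l else e2 l) B,
      restrict (case p of (e2, e1) \<Rightarrow> \<lambda>l. if l \<in> A then e1 l else e2 l) A) = p"
      by (simp add: p')
  qed
  also have "\<dots> = scale (\<Sum>e\<in>choices B. H e) (\<Sum>e\<in>choices A. G e)"
    unfolding scale_sum_left sum.cartesian_product[symmetric] by (simp only: scale_sum_right)
  finally show ?thesis .
qed

text \<open>The pairs of \<open>M\<close> and the unmatched letters partition \<open>L\<close>, and
  each factor depends only on the parts of its own letters. One pair is split off at a time; the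
  unmatched set stays the same, so the locality of \<open>G\<close> is preserved.\<close>

lemma sum_choices_matching:
  fixes G :: "(nat \<Rightarrow> part) \<Rightarrow> 'a" and h :: "nat \<times> nat \<Rightarrow> (nat \<Rightarrow> part) \<Rightarrow> complex"
  assumes "finite L" "M \<in> matchings L"
    and "\<And>e e'. (\<And>l. l \<in> unmatched L M \<Longrightarrow> e l = e' l) \<Longrightarrow> G e = G e'"
    and h: "\<And>p e e'. e (fst p) = e' (fst p) \<Longrightarrow> e (snd p) = e' (snd p) \<Longrightarrow> h p e = h p e'"
  shows "(\<Sum>e\<in>choices L. scale (\<Prod>p\<in>M. h p e) (G e)) =
    scale (\<Prod>p\<in>M. \<Sum>e\<in>choices {fst p, snd p}. h p e) (\<Sum>e\<in>choices (unmatched L M). G e)"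
proof -
  have "finite M" using assms(1,2) by (rule finite_matching)
  then show ?thesis using assms(1-3)
  proof (induction M arbitrary: L rule: finite_induct)
    case empty
    show ?case by (simp add: unmatched_def)
  next
    case (insert p M)
    obtain i j where p: "p = (i, j)" by fastforce
    with insert.prems insert.hyps have M: "M \<in> matchings (L - {i, j})"
      using matchings_remove[of "insert p M" L i j] by simp
    from p insert.prems(2) have ij: "i \<in> L" "j \<in> L" by (auto simp: matchings_def)
    have u: "unmatched L (insert p M) = unmatched (L - {i, j}) M"
      unfolding p by (rule unmatched_insert)
    have L: "(L - {i, j}) \<union> {i, j} = L" using ij by auto
    have "(\<Sum>e\<in>choices L. scale (\<Prod>p\<in>insert p M. h p e) (G e)) =
      (\<Sum>e\<in>choices ((L - {i, j}) \<union> {i, j}). scale (h p e) (scale (\<Prod>p\<in>M. h p e) (G e)))"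
      unfolding L using insert.hyps by simp
    also have "\<dots> = scale (\<Sum>e\<in>choices {i, j}. h p e)
      (\<Sum>e\<in>choices (L - {i, j}). scale (\<Prod>p\<in>M. h p e) (G e))"
    proof (rule sum_choices_union)
      fix e e' :: "nat \<Rightarrow> part" assume eq: "\<And>l. l \<in> L - {i, j} \<Longrightarrow> e l = e' l"
      have "fst q \<in> L - {i, j} \<and> snd q \<in> L - {i, j}" if "q \<in> M" for q
        using matching_pairs_subset[OF M] that by blast
      then have "(\<Prod>p\<in>M. h p e) = (\<Prod>p\<in>M. h p e')"
        using eq by (intro prod.cong h) blast+
      moreover have "G e = G e'"
        using eq u by (intro insert.prems(3)) (auto simp: unmatched_def)
      ultimately show "scale (\<Prod>p\<in>M. h p e) (G e) = scale (\<Prod>p\<in>M. h p e') (G e')" by simp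
    qed (auto intro: h simp: p)
    also have "(\<Sum>e\<in>choices (L - {i, j}). scale (\<Prod>p\<in>M. h p e) (G e)) =
      scale (\<Prod>p\<in>M. \<Sum>e\<in>choices {fst p, snd p}. h p e)
        (\<Sum>e\<in>choices (unmatched (L - {i, j}) M). G e)"
      using insert.prems(1) by (intro insert.IH M insert.prems(3)) (simp_all only: u finite_Diff)
    finally show ?case
      using insert.hyps by (simp add: u[unfolded p] p)
  qed
qed

lemma ordered_prod_cong:
  "(\<And>l. l \<in> S \<Longrightarrow> x l = y l) \<Longrightarrow> ordered_prod \<sigma> x as S = ordered_prod \<sigma> y as S"
  unfolding ordered_prod_def
  by (intro arg_cong2[where f = scale] arg_cong[where f = prod_list] map_cong) auto

text \<open>The normal order itself varies with \<open>e\<close>, but its restriction to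
  \<open>S\<close> is fixed by the parts of the letters in \<open>S\<close>.\<close>

lemma ordered_prod_normal_cong:
  assumes "\<And>l. l \<in> S \<Longrightarrow> e l = e' l"
  shows "ordered_prod \<sigma> (\<lambda>l. \<psi> (e l) l) (normal_list e as) S =
    ordered_prod \<sigma> (\<lambda>l. \<psi> (e' l) l) (normal_list e' as) S"
proof -
  have "normal_list e (filter (\<lambda>l. l \<in> S) as) = normal_list e' (filter (\<lambda>l. l \<in> S) as)"
    using assms by (intro normal_list_cong) auto
  then have "ordered_prod \<sigma> (\<lambda>l. \<psi> (e l) l) (normal_list e as) S =
    ordered_prod \<sigma> (\<lambda>l. \<psi> (e l) l) (normal_list e' as) S"
    unfolding ordered_prod_def normal_list_filter by simp
  also have "\<dots> = ordered_prod \<sigma> (\<lambda>l. \<psi> (e' l) l) (normal_list e' as) S"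
    using assms by (intro ordered_prod_cong) simp
  finally show ?thesis .
qed

lemma filter_strict_sorted:
  fixes as :: "nat list"
  assumes "sorted_wrt (<) as" "S \<subseteq> set as"
  shows "filter (\<lambda>l. l \<in> S) as = sorted_list_of_set S"
proof -
  have "finite S" using assms(2) finite_subset by auto
  then show ?thesis
    using assms by (intro strict_sorted_equal) (auto intro: sorted_wrt_filter)
qed

text \<open>The order on the right is that of the full word, so that for one choice of parts every
  pair and every unmatched set refers to the same order.\<close>

lemma normal_ordered_subset:
  assumes "sorted_wrt (<) as" "S \<subseteq> set as"
  shows "normal_ordered scale \<sigma> \<psi> (sorted_list_of_set S) =
    (\<Sum>e\<in>choices S. ordered_prod \<sigma> (\<lambda>l. \<psi> (e l) l) (normal_list e as) S)"
proof -
  have S: "set (filter (\<lambda>l. l \<in> S) as) = S" using assms(2) by auto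
  show ?thesis
    using normal_ordered_eq[OF sorted_wrt_filter[OF assms(1)], of \<sigma> \<psi> "\<lambda>l. l \<in> S"]
    by (simp only: S filter_strict_sorted[OF assms, symmetric] normal_list_filter[symmetric]
        ordered_prod_filter[OF subset_refl])
qed

text \<open>Filtering commutes with sorting, so a subset inherits its time order from the full
  word.\<close>

lemma time_ordered_subset:
  assumes "\<sigma> = 1 \<or> \<sigma> = -1" "sorted_wrt (<) as" "S \<subseteq> set as" "inj_on t (set as)"
  shows "time_ordered scale \<sigma> t \<psi> (sorted_list_of_set S) =
    (\<Sum>e\<in>choices S. ordered_prod \<sigma> (\<lambda>l. \<psi> (e l) l) (rev (sort_key t as)) S)"
proof -
  have S: "set (filter (\<lambda>l. l \<in> S) as) = S" using assms(3) by auto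
  have f: "rev (sort_key t (filter (\<lambda>l. l \<in> S) as)) = filter (\<lambda>l. l \<in> S) (rev (sort_key t as))"
    by (simp only: filter_sort rev_filter[symmetric])
  have "inj_on t (set (filter (\<lambda>l. l \<in> S) as))" using assms(4) by (rule inj_on_subset) auto
  from time_ordered_eq[OF assms(1) sorted_wrt_filter[OF assms(2)] this, of \<psi>] show ?thesis
    by (simp only: S f filter_strict_sorted[OF assms(2,3), symmetric]
        ordered_prod_filter[OF subset_refl])
qed

lemma prod_list_scale_one:
  "prod_list (map (\<lambda>p. scale (f p) 1) ps) = scale (\<Prod>p\<leftarrow>ps. f p) (1 :: 'a)"
  by (induction ps) (simp_all add: scale_mult_left)

text \<open>Each choice of parts is handled by \<open>ordered_prod_eq_wick_sum\<close> with the time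
  order and the normal order of that choice. After the two sums are exchanged, the sum over choices
  factorises for every matching.\<close>

theorem time_ordered_eq_sum_matchings:
  assumes "\<sigma> = 1 \<or> \<sigma> = -1" "sorted_wrt (<) as" "inj_on t (set as)"
    and cn: "\<And>i j e e'. i \<in> set as \<Longrightarrow> j \<in> set as \<Longrightarrow> i \<noteq> j \<Longrightarrow>
      c_number scale (bracket scale \<sigma> (\<psi> e i) (\<psi> e' j))"
  shows "time_ordered scale \<sigma> t \<psi> as =
    (\<Sum>M\<in>matchings (set as). scale (list_sign \<sigma> (matching_list (set as) M))
      (normal_ordered scale \<sigma> \<psi> (sorted_list_of_set (unmatched (set as) M)) *
       prod_list (map (\<lambda>(i, j). contraction scale \<sigma> t \<psi> i j) (sorted_list_of_set M))))"
proof (cases "(1::'a) = 0")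
  case True
  \<comment> \<open>In the zero algebra all elements coincide; in every other algebra
    \<open>c_value\<close> is determined on c-numbers.\<close>
  then have "x = y" for x y :: 'a by (metis mult_1 mult_zero_left)
  then show ?thesis .
next
  case one: False
  let ?L = "set as" and ?ta = "rev (sort_key t as)"
  let ?x = "\<lambda>e l. \<psi> (e l) l" and ?bs = "\<lambda>e. normal_list e as"
  define h where "h = (\<lambda>p e. pair_coeff \<sigma> (?x e) ?ta (?bs e) p)"
  have ss: "\<sigma> * \<sigma> = 1" using assms(1) by auto
  have d: "distinct as" using assms(2) strict_sorted_iff by blast
  have contraction: "contraction scale \<sigma> t \<psi> i j = scale (\<Sum>e\<in>choices {i, j}. h (i, j) e) 1"
    if ij: "i < j" "i \<in> ?L" "j \<in> ?L" for i j
  proof -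
    \<comment> \<open>Since \<open>i < j\<close>, the word is the sorted list of its set, so the
      subset lemmas apply to both of its ordered products.\<close>
    have l: "sorted_list_of_set {i, j} = [i, j]"
      using ij(1) by simp
    have sub: "{i, j} \<subseteq> ?L" using ij by auto
    have "scale (h (i, j) e) 1 =
      ordered_prod \<sigma> (?x e) ?ta {i, j} - ordered_prod \<sigma> (?x e) (?bs e) {i, j}" for e
      unfolding h_def using ij d distinct_normal_list[OF d]
      by (intro scale_pair_coeff[OF ss]) (auto intro: cn)
    then show ?thesis
      unfolding contraction_def l[symmetric] time_ordered_subset[OF assms(1,2) sub assms(3)]
        normal_ordered_subset[OF assms(2) sub]
      by (simp add: scale_sum_left sum_subtractf)
  qed
  have h_cong: "h p e = h p e'" if "e (fst p) = e' (fst p)" "e (snd p) = e' (snd p)" for p e e'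
    using that unfolding h_def pair_coeff_def
    by (intro arg_cong[where f = c_value] arg_cong2[where f = minus] ordered_prod_cong
        ordered_prod_normal_cong) auto
  have "time_ordered scale \<sigma> t \<psi> as = (\<Sum>e\<in>choices ?L. ordered_prod \<sigma> (?x e) ?ta ?L)"
    by (rule time_ordered_eq[OF assms(1-3)])
  also have "\<dots> = (\<Sum>e\<in>choices ?L. wick_sum \<sigma> (?x e) ?ta (?bs e) ?L)"
    using d distinct_normal_list[OF d]
    by (intro sum.cong HOL.refl ordered_prod_eq_wick_sum[OF ss one]) (auto intro: cn)
  also have "\<dots> = (\<Sum>M\<in>matchings ?L. \<Sum>e\<in>choices ?L.
      scale (list_sign \<sigma> (matching_list ?L M) * (\<Prod>p\<in>M. h p e))
        (ordered_prod \<sigma> (?x e) (?bs e) (unmatched ?L M)))"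
    unfolding wick_sum_def h_def by (rule sum.swap)
  also have "\<dots> = (\<Sum>M\<in>matchings ?L. scale (list_sign \<sigma> (matching_list ?L M))
      (\<Sum>e\<in>choices ?L. scale (\<Prod>p\<in>M. h p e)
        (ordered_prod \<sigma> (?x e) (?bs e) (unmatched ?L M))))"
    by (simp add: scale_sum_right)
  also have "\<dots> = (\<Sum>M\<in>matchings ?L. scale (list_sign \<sigma> (matching_list ?L M))
      (normal_ordered scale \<sigma> \<psi> (sorted_list_of_set (unmatched ?L M)) *
       prod_list (map (\<lambda>(i, j). contraction scale \<sigma> t \<psi> i j) (sorted_list_of_set M))))"
  proof (intro sum.cong HOL.refl arg_cong2[where f = scale])
    fix M assume M: "M \<in> matchings ?L"
    have finM: "finite M" using finite_matching[OF _ M] by simp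
    have sub: "unmatched ?L M \<subseteq> ?L" by (auto simp: unmatched_def)
    have "(\<Sum>e\<in>choices ?L. scale (\<Prod>p\<in>M. h p e) (ordered_prod \<sigma> (?x e) (?bs e) (unmatched ?L M))) =
      scale (\<Prod>p\<in>M. \<Sum>e\<in>choices {fst p, snd p}. h p e)
        (\<Sum>e\<in>choices (unmatched ?L M). ordered_prod \<sigma> (?x e) (?bs e) (unmatched ?L M))"
      by (intro sum_choices_matching M h_cong ordered_prod_normal_cong) auto
    also have "\<dots> = scale (\<Prod>p\<in>M. \<Sum>e\<in>choices {fst p, snd p}. h p e)
        (normal_ordered scale \<sigma> \<psi> (sorted_list_of_set (unmatched ?L M)))"
      by (simp only: normal_ordered_subset[OF assms(2) sub])
    also have "(\<Prod>p\<in>M. \<Sum>e\<in>choices {fst p, snd p}. h p e) =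
      (\<Prod>p\<leftarrow>sorted_list_of_set M. \<Sum>e\<in>choices {fst p, snd p}. h p e)"
      using finM by (subst prod.distinct_set_conv_list[symmetric]) auto
    \<comment> \<open>The scalar becomes a product of c-numbers, one for each contraction, standing
      behind the normal ordered product.\<close>
    also have "scale \<dots> (normal_ordered scale \<sigma> \<psi> (sorted_list_of_set (unmatched ?L M))) =
      normal_ordered scale \<sigma> \<psi> (sorted_list_of_set (unmatched ?L M)) *
        prod_list (map (\<lambda>p. scale (\<Sum>e\<in>choices {fst p, snd p}. h p e) 1) (sorted_list_of_set M))"
      by (simp add: prod_list_scale_one scale_mult_right)
    also have "map (\<lambda>p. scale (\<Sum>e\<in>choices {fst p, snd p}. h p e) 1) (sorted_list_of_set M) =
      map (\<lambda>(i, j). contraction scale \<sigma> t \<psi> i j) (sorted_list_of_set M)"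
      using M finM by (intro map_cong HOL.refl) (auto simp: matchings_def contraction)
    finally show "(\<Sum>e\<in>choices ?L. scale (\<Prod>p\<in>M. h p e)
        (ordered_prod \<sigma> (?x e) (?bs e) (unmatched ?L M))) =
      normal_ordered scale \<sigma> \<psi> (sorted_list_of_set (unmatched ?L M)) *
        prod_list (map (\<lambda>(i, j). contraction scale \<sigma> t \<psi> i j) (sorted_list_of_set M))" .
  qed
  finally show ?thesis .
qed

end

section \<open>Wick permutations as partial matchings\<close>

definition perm_matching :: "nat \<Rightarrow> nat \<Rightarrow> (nat \<Rightarrow> nat) \<Rightarrow> (nat \<times> nat) set" where
  "perm_matching n m b = (\<lambda>j. (b (2 * j - 1), b (2 * j))) ` {m + 1..n}"

text \<open>Lists are indexed from 0 and labels from 1, hence \<open>k - 1\<close>; outside the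
  labels the map is the identity, as \<open>permutes\<close> demands.\<close>

definition matching_perm :: "nat \<Rightarrow> (nat \<times> nat) set \<Rightarrow> nat \<Rightarrow> nat" where
  "matching_perm n M k = (if k \<in> {1..2 * n} then matching_list {1..2 * n} M ! (k - 1) else k)"

lemma flatten_pairs_map_upt:
  "m \<le> n \<Longrightarrow> flatten_pairs (map (\<lambda>j. (b (2 * j - 1), b (2 * j))) [m + 1..<n + 1]) =
    map b [2 * m + 1..<2 * n + 1]"
  by (induction n rule: dec_induct) auto

lemma flatten_pairs_inject:
  "flatten_pairs ps = flatten_pairs qs \<longleftrightarrow> ps = qs"
proof (induction ps arbitrary: qs)
  case Nil
  then show ?case by (cases qs) auto
next
  case (Cons p ps)
  then show ?case by (cases qs) (auto simp: prod_eq_iff)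
qed

lemma length_flatten_pairs: "length (flatten_pairs ps) = 2 * length ps"
  by (induction ps) auto

lemma sorted_wrt_map_upt:
  fixes f :: "nat \<Rightarrow> 'b::linorder"
  shows "sorted_wrt (<) (map f [a..<b]) \<longleftrightarrow> strict_mono_on {a..<b} f"
proof
  assume "sorted_wrt (<) (map f [a..<b])"
  then have *: "f (a + k) < f (a + l)" if "k < l" "a + l < b" for k l
    using that by (auto simp: sorted_wrt_iff_nth_less)
  show "strict_mono_on {a..<b} f"
  proof (rule strict_mono_onI)
    fix r s assume "r \<in> {a..<b}" "s \<in> {a..<b}" "r < s"
    then show "f r < f s" using *[of "r - a" "s - a"] by auto
  qed
next
  assume "strict_mono_on {a..<b} f"
  then show "sorted_wrt (<) (map f [a..<b])"
    unfolding sorted_wrt_iff_nth_less by (auto intro: strict_mono_onD)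
qed

lemma map_upt_split:
  "m \<le> (n::nat) \<Longrightarrow> map b [1..<2 * n + 1] = map b [1..<2 * m + 1] @ map b [2 * m + 1..<2 * n + 1]"
  using upt_add_eq_append[of 1 "2 * m + 1" "2 * n - 2 * m"] by (simp del: upt_Suc)

text \<open>The first \<open>2 * m\<close> values increase, and so do the first components of the
  pairs, so \<open>b\<close> lists its values in the very order that \<open>matching_list\<close>
  uses.\<close>

lemma wick_perm_matching:
  assumes "m \<le> n" "b \<in> wick_perms n m"
  shows "perm_matching n m b \<in> matchings {1..2 * n}" (is "?M \<in> matchings ?L")
    and "sorted_list_of_set (perm_matching n m b) =
      map (\<lambda>j. (b (2 * j - 1), b (2 * j))) [m + 1..<n + 1]"
    and "sorted_list_of_set (unmatched {1..2 * n} (perm_matching n m b)) = map b [1..<2 * m + 1]"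
    and "matching_list {1..2 * n} (perm_matching n m b) = map b [1..<2 * n + 1]"
    and "card (perm_matching n m b) = n - m"
proof -
  let ?pairs = "map (\<lambda>j. (b (2 * j - 1), b (2 * j))) [m + 1..<n + 1]"
  from assms(2) have p: "b permutes ?L" and m1: "strict_mono_on {1..2 * m} b"
    and lt: "\<And>j. j \<in> {m + 1..n} \<Longrightarrow> b (2 * j - 1) < b (2 * j)"
    and m2: "strict_mono_on {m + 1..n} (\<lambda>j. b (2 * j - 1))"
    by (auto simp: wick_perms_def)
  have inj: "b k = b l \<longleftrightarrow> k = l" for k l using permutes_inj[OF p] by (auto simp: inj_def)
  have bL: "b k \<in> ?L \<longleftrightarrow> k \<in> ?L" for k by (rule permutes_in_image[OF p])
  have in_L: "2 * j - 1 \<in> ?L" "2 * j \<in> ?L" if "j \<in> {m + 1..n}" for j using that by auto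
  show "?M \<in> matchings ?L"
    unfolding matchings_def
  proof (intro CollectI conjI)
    show "?M \<subseteq> {(i, j). i < j \<and> i \<in> ?L \<and> j \<in> ?L}"
      using lt bL in_L by (auto simp: perm_matching_def simp del: atLeastAtMost_iff)
    show "pairwise (\<lambda>p q. {fst p, snd p} \<inter> {fst q, snd q} = {}) ?M"
      \<comment> \<open>Injectivity of \<open>b\<close> reduces disjointness to positions, where
        \<open>2 * j - 1\<close> and \<open>2 * j\<close> for different \<open>j\<close> never
        coincide.\<close>
      by (auto simp: perm_matching_def pairwise_def inj) presburger+
  qed
  have set: "set ?pairs = ?M"
    by (simp add: perm_matching_def atLeastLessThanSuc_atLeastAtMost del: upt_Suc)
  have "sorted_wrt (<) ?pairs"
    using m2 unfolding sorted_wrt_map_upt strict_mono_on_def less_prod_def by auto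
  then show sM: "sorted_list_of_set ?M = ?pairs"
    unfolding set[symmetric] by (rule sorted_list_of_set_strict_sorted)
  have "unmatched ?L ?M = ?L - set (flatten_pairs ?pairs)"
    by (simp only: unmatched_def set_flatten_pairs set)
  also have "\<dots> = b ` ?L - b ` {2 * m + 1..2 * n}"
    using assms(1) by (simp only: flatten_pairs_map_upt permutes_image[OF p])
      (simp add: atLeastLessThanSuc_atLeastAtMost del: upt_Suc)
  also have "\<dots> = b ` (?L - {2 * m + 1..2 * n})"
    by (rule image_set_diff[symmetric, OF permutes_inj[OF p]])
  also have "?L - {2 * m + 1..2 * n} = {1..2 * m}" using assms(1) by auto
  also have "b ` {1..2 * m} = set (map b [1..<2 * m + 1])"
    by (simp add: atLeastLessThanSuc_atLeastAtMost del: upt_Suc)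
  finally have u: "unmatched ?L ?M = set (map b [1..<2 * m + 1])" .
  have "sorted_wrt (<) (map b [1..<2 * m + 1])"
    unfolding sorted_wrt_map_upt using m1 by (simp add: atLeastLessThanSuc_atLeastAtMost)
  then show sU: "sorted_list_of_set (unmatched ?L ?M) = map b [1..<2 * m + 1]"
    unfolding u by (rule sorted_list_of_set_strict_sorted)
  show "matching_list ?L ?M = map b [1..<2 * n + 1]"
    unfolding matching_list_def sM sU flatten_pairs_map_upt[OF assms(1)]
    by (rule map_upt_split[OF assms(1), symmetric])
  show "card ?M = n - m"
    using sM by (metis (no_types, lifting) length_map length_sorted_list_of_set length_upt
        add_diff_cancel_right)
qed

text \<open>The inverse construction. The value of \<open>m\<close> is forced, as a matching with
  \<open>card M\<close> pairs leaves \<open>2 * n - 2 * card M\<close> letters unmatched.\<close>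

lemma matching_perm:
  assumes "M \<in> matchings {1..2 * n}"
  defines "m \<equiv> n - card M"
  shows "m \<le> n" and "matching_perm n M \<in> wick_perms n m"
    and "perm_matching n m (matching_perm n M) = M"
proof -
  let ?L = "{1..2 * n}" and ?b = "matching_perm n M"
  let ?l = "matching_list ?L M"
  let ?pairs = "map (\<lambda>j. (?b (2 * j - 1), ?b (2 * j))) [m + 1..<n + 1]"
  show "m \<le> n" by (simp add: m_def)
  have finM: "finite M" using finite_matching[OF _ assms(1)] by simp
  have d: "distinct ?l" and s: "set ?l = ?L"
    using distinct_matching_list[OF _ assms(1)] set_matching_list[OF _ assms(1)] by auto
  have len: "length ?l = 2 * n" using distinct_card[OF d] s by simp
  have map_b: "map ?b [1..<2 * n + 1] = ?l"
  proof (rule nth_equalityI)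
    show "length (map ?b [1..<2 * n + 1]) = length ?l" by (simp add: len del: upt_Suc One_nat_def)
    fix i assume "i < length (map ?b [1..<2 * n + 1])"
    then show "map ?b [1..<2 * n + 1] ! i = ?l ! i"
      by (simp add: matching_perm_def del: upt_Suc One_nat_def)
  qed
  \<comment> \<open>This count bounds \<open>card M\<close> by \<open>n\<close>, so the truncated
    subtraction in \<open>m\<close> is exact.\<close>
  have "card (unmatched ?L M) + 2 * card M = 2 * n"
    using len finM by (simp add: matching_list_def length_flatten_pairs)
  then have card: "card (unmatched ?L M) = 2 * m" by (simp add: m_def)
  have "map ?b [1..<2 * m + 1] @ map ?b [2 * m + 1..<2 * n + 1] =
    sorted_list_of_set (unmatched ?L M) @ flatten_pairs (sorted_list_of_set M)"
    using map_b unfolding map_upt_split[OF \<open>m \<le> n\<close>] matching_list_def .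
  \<comment> \<open>Both splittings begin with a block of length \<open>2 * m\<close>, so the lists
    can be compared block by block.\<close>
  then have U: "map ?b [1..<2 * m + 1] = sorted_list_of_set (unmatched ?L M)"
    and "map ?b [2 * m + 1..<2 * n + 1] = flatten_pairs (sorted_list_of_set M)"
    using card by (simp_all add: append_eq_append_conv)
  then have P: "?pairs = sorted_list_of_set M"
    by (simp only: flatten_pairs_map_upt[OF \<open>m \<le> n\<close>, symmetric] flatten_pairs_inject)
  have PM: "(?b (2 * j - 1), ?b (2 * j)) \<in> M" if "j \<in> {m + 1..n}" for j
  proof -
    have "(?b (2 * j - 1), ?b (2 * j)) \<in> set ?pairs" using that by (auto simp del: upt_Suc)
    then show ?thesis unfolding P using finM by simp
  qed
  show "perm_matching n m ?b = M"
  proof -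
    have "perm_matching n m ?b = set ?pairs"
      by (simp add: perm_matching_def atLeastLessThanSuc_atLeastAtMost del: upt_Suc)
    then show ?thesis unfolding P using finM by simp
  qed
  have "inj_on ?b ?L" "?b ` ?L = ?L"
    using d s unfolding map_b[symmetric] distinct_map
    by (simp_all add: atLeastLessThanSuc_atLeastAtMost del: upt_Suc)
  then have "?b permutes ?L"
    by (intro bij_imp_permutes) (auto simp: bij_betw_def matching_perm_def)
  moreover have "strict_mono_on {1..2 * m} ?b"
  proof -
    have "sorted_wrt (<) (map ?b [1..<2 * m + 1])" unfolding U by simp
    then show ?thesis unfolding sorted_wrt_map_upt by (simp add: atLeastLessThanSuc_atLeastAtMost)
  qed
  moreover have "\<forall>j\<in>{m + 1..n}. ?b (2 * j - 1) < ?b (2 * j)"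
    using PM assms(1) by (fastforce simp: matchings_def)
  moreover have "strict_mono_on {m + 1..n} (\<lambda>j. ?b (2 * j - 1))"
  proof (rule strict_mono_onI)
    fix j k assume jk: "j \<in> {m + 1..n}" "k \<in> {m + 1..n}" "j < k"
    have "sorted_wrt (<) ?pairs" unfolding P by simp
    then have mono: "strict_mono_on {m + 1..<n + 1} (\<lambda>j. (?b (2 * j - 1), ?b (2 * j)))"
      unfolding sorted_wrt_map_upt .
    \<comment> \<open>Lexicographic order alone would allow equal first components; distinct pairs
      of a matching are disjoint, which excludes this.\<close>
    have less: "(?b (2 * j - 1), ?b (2 * j)) < (?b (2 * k - 1), ?b (2 * k))" (is "?p < ?q")
      using jk by (intro strict_mono_onD[OF mono]) auto
    have "?p \<in> M" "?q \<in> M" using PM jk by auto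
    moreover have "?p \<noteq> ?q" by (rule less_imp_neq[OF less])
    ultimately have "?b (2 * j - 1) \<noteq> ?b (2 * k - 1)"
      using assms(1) unfolding matchings_def pairwise_def by fastforce
    with less show "?b (2 * j - 1) < ?b (2 * k - 1)"
      by (auto simp: less_prod_def)
  qed
  ultimately show "?b \<in> wick_perms n m" by (simp add: wick_perms_def)
qed

lemma matching_perm_perm_matching:
  assumes "m \<le> n" "b \<in> wick_perms n m"
  shows "matching_perm n (perm_matching n m b) = b"
proof
  fix k
  have "b permutes {1..2 * n}" using assms(2) by (simp add: wick_perms_def)
  then have "b k = k" if "k \<notin> {1..2 * n}" using that by (auto simp: permutes_def)
  then show "matching_perm n (perm_matching n m b) k = b k"
    unfolding matching_perm_def wick_perm_matching(4)[OF assms] by (auto simp del: upt_Suc)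
qed

lemma finite_wick_perms: "finite (wick_perms n m)"
  by (rule finite_subset[of _ "{b. b permutes {1..2 * n}}"])
    (auto simp: wick_perms_def finite_permutations)

text \<open>The number of pairs determines \<open>m\<close>, so the double sum runs over all partial
  matchings, each counted once.\<close>

lemma sum_wick_perms:
  "(\<Sum>m = 0..n. \<Sum>b\<in>wick_perms n m. f m b) =
    (\<Sum>M\<in>matchings {1..2 * n}. f (n - card M) (matching_perm n M))"
proof -
  have "(\<Sum>m = 0..n. \<Sum>b\<in>wick_perms n m. f m b) = (\<Sum>(m, b)\<in>Sigma {0..n} (wick_perms n). f m b)"
    by (rule sum.Sigma) (auto simp: finite_wick_perms)
  also have "\<dots> = (\<Sum>M\<in>matchings {1..2 * n}. f (n - card M) (matching_perm n M))"
    by (rule sum.reindex_bij_witness[where i = "\<lambda>M. (n - card M, matching_perm n M)"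
          and j = "\<lambda>(m, b). perm_matching n m b"])
      (auto simp: wick_perm_matching matching_perm matching_perm_perm_matching simp del: One_nat_def)
  finally show ?thesis .
qed

theorem mainTheorem1:
  fixes scale :: "complex \<Rightarrow> 'a::{ring, monoid_mult} \<Rightarrow> 'a"
    and \<sigma> :: complex
    and t :: "nat \<Rightarrow> 't::linorder"
    and \<psi> :: "part \<Rightarrow> nat \<Rightarrow> 'a"
    and n :: nat
  assumes "complex_algebra scale"
    and "\<sigma> = 1 \<or> \<sigma> = -1"
    and "n \<ge> 1"
    and "inj_on t {1..2 * n}"
    and "\<And>i j e e'. i \<in> {1..2 * n} \<Longrightarrow> j \<in> {1..2 * n} \<Longrightarrow> i \<noteq> j \<Longrightarrow>
      c_number scale (bracket scale \<sigma> (\<psi> e i) (\<psi> e' j))"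
  shows "time_ordered scale \<sigma> t \<psi> [1..<2 * n + 1] =
    (\<Sum>m = 0..n. \<Sum>b\<in>wick_perms n m.
      scale (perm_factor \<sigma> b)
        (normal_ordered scale \<sigma> \<psi> (map b [1..<2 * m + 1]) *
         prod_list (map (\<lambda>j. contraction scale \<sigma> t \<psi> (b (2 * j - 1)) (b (2 * j)))
           [m + 1..<n + 1])))"
proof -
  interpret complex_algebra scale by fact
  let ?L = "{1..2 * n}"
  have L: "set [1..<2 * n + 1] = ?L"
    by (simp add: atLeastLessThanSuc_atLeastAtMost del: upt_Suc)
  have "time_ordered scale \<sigma> t \<psi> [1..<2 * n + 1] =
    (\<Sum>M\<in>matchings ?L. scale (list_sign \<sigma> (matching_list ?L M))
      (normal_ordered scale \<sigma> \<psi> (sorted_list_of_set (unmatched ?L M)) *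
       prod_list (map (\<lambda>(i, j). contraction scale \<sigma> t \<psi> i j) (sorted_list_of_set M))))"
    unfolding L[symmetric]
    by (rule time_ordered_eq_sum_matchings) (use assms(2,4,5) in \<open>simp_all only: L sorted_wrt_upt\<close>)
  \<comment> \<open>Applied to the right side, \<open>sum_wick_perms\<close> returns a sum over
    matchings, in which \<open>perm_matching\<close> undoes \<open>matching_perm\<close>.\<close>
  also have "\<dots> = (\<Sum>m = 0..n. \<Sum>b\<in>wick_perms n m.
      scale (list_sign \<sigma> (matching_list ?L (perm_matching n m b)))
      (normal_ordered scale \<sigma> \<psi> (sorted_list_of_set (unmatched ?L (perm_matching n m b))) *
       prod_list (map (\<lambda>(i, j). contraction scale \<sigma> t \<psi> i j)
         (sorted_list_of_set (perm_matching n m b)))))"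
    unfolding sum_wick_perms by (simp add: matching_perm del: One_nat_def)
  also have "\<dots> = (\<Sum>m = 0..n. \<Sum>b\<in>wick_perms n m.
      scale (perm_factor \<sigma> b)
        (normal_ordered scale \<sigma> \<psi> (map b [1..<2 * m + 1]) *
         prod_list (map (\<lambda>j. contraction scale \<sigma> t \<psi> (b (2 * j - 1)) (b (2 * j)))
           [m + 1..<n + 1])))"
  proof (intro sum.cong HOL.refl)
    fix m b assume m: "m \<in> {0..n}" and b: "b \<in> wick_perms n m"
    have mn: "m \<le> n" using m by simp
    have "b permutes {1..<2 * n + 1}"
      using b by (simp add: wick_perms_def atLeastLessThanSuc_atLeastAtMost)
    \<comment> \<open>The signature of \<open>b\<close> is the sign of its list of values, and that
      list is the matching list.\<close>
    then have pf: "perm_factor \<sigma> b = list_sign \<sigma> (map b [1..<2 * n + 1])"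
      by (rule perm_factor_eq_list_sign[OF assms(2)])
    show "scale (list_sign \<sigma> (matching_list ?L (perm_matching n m b)))
      (normal_ordered scale \<sigma> \<psi> (sorted_list_of_set (unmatched ?L (perm_matching n m b))) *
       prod_list (map (\<lambda>(i, j). contraction scale \<sigma> t \<psi> i j)
         (sorted_list_of_set (perm_matching n m b)))) =
      scale (perm_factor \<sigma> b)
        (normal_ordered scale \<sigma> \<psi> (map b [1..<2 * m + 1]) *
         prod_list (map (\<lambda>j. contraction scale \<sigma> t \<psi> (b (2 * j - 1)) (b (2 * j)))
           [m + 1..<n + 1]))"
      unfolding wick_perm_matching(2-4)[OF mn b] pf by (simp only: map_map o_def prod.case)
  qed
  finally show ?thesis .
qed

end
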